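(* Let $p$ be a prime integer. Then, up to conjugacy, any subgroup of $\operatorname{Atp}(\mathbb{Z}_p)\cong\operatorname{Aut}(\mathbb{Z}_p)\ltimes\mathbb{Z}_p^2$ is the product of a subgroup of $\operatorname{Aut}(\mathbb{Z}_p)=\mathbb{Z}_p^\ast$ by a subgroup of $\mathbb{Z}_p^2$. More precisely, let $m_0$ be a generator of the cyclic group $\mathbb{Z}_p^\ast$ and, for each $d$ dividing $p-1$, let $H_d=\langle m_0^d\rangle$ be the subgroup of $\mathbb{Z}_p^\ast$ of order $(p-1)/d$. The following is a set of representatives $S$ for the conjugacy classes of subgroups of $\operatorname{Atp}(\mathbb{Z}_p)$, where $y$ ranges over $\mathbb{Z}_p$ and $d$ over the divisors of $p-1$ subject to the indicated restriction, together with their normalizers $N(S)$: (1) $S=\{1\}=1\ltimes\{(0,0)\}$, with $N(S)=\operatorname{Atp}(\mathbb{Z}_p)$; (2) $S=1\ltimes\langle(1,y)\rangle$, with $N(S)=\operatorname{Atp}(\mathbb{Z}_p)$; (3) $S=1\ltimes\langle(0,1)\rangle$, with $N(S)=\operatorname{Atp}(\mathbb{Z}_p)$; (4) $S=H_d$ with $d\neq p-1$, with $N(S)=\operatorname{Aut}(\mathbb{Z}_p)$; (5) $S=H_d\ltimes\langle(1,y)\rangle$ with $d\neq p-1$, with $N(S)=\operatorname{Aut}(\mathbb{Z}_p)\ltimes\langle(1-m_0^d)^{-1}\cdot(1,y)\rangle$; (6) $S=H_d\ltimes\langle(0,1)\rangle$ with $d\neq p-1$, with $N(S)=\operatorname{Aut}(\mathbb{Z}_p)\ltimes\langle(1-m_0^d)^{-1}\cdot(0,1)\rangle$;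 (7) $S=H_d\ltimes\mathbb{Z}_p^2$, with $N(S)=\operatorname{Atp}(\mathbb{Z}_p)$.
   Context: An autotopism of a group $(G,\cdot)$ is a triple $(\alpha,\beta,\gamma)$ of bijections $G\to G$ with $\alpha(x)\cdot\beta(y)=\gamma(x\cdot y)$ for all $x,y$; $\operatorname{Atp}(G)$ is the group of autotopisms under componentwise composition. For $G=\mathbb{Z}_p=\mathbb{Z}/p\mathbb{Z}$, $\operatorname{Atp}(\mathbb{Z}_p)$ is identified with $\operatorname{Aut}(\mathbb{Z}_p)\ltimes\mathbb{Z}_p^2$, with multiplication $(h,X)(h',X')=(hh',hX'+X)$, where $(h,(x_0,y_0))$ corresponds to the autotopism $(x\mapsto hx+x_0,\ y\mapsto hy+y_0,\ z\mapsto hz+x_0+y_0)$. $\operatorname{Aut}(\mathbb{Z}_p)$ is identified with $\mathbb{Z}_p^\ast$ (acting by multiplication). For subgroups $H\le\mathbb{Z}_p^\ast$ and $Q\le\mathbb{Z}_p^2$, the product $H\ltimes Q$ is $\{(h,X):h\in H,\ X\in Q\}$; a subgroup $H\le\mathbb{Z}_p^\ast$ alone is identified with $H\ltimes\{(0,0)\}$. $\langle\cdot\rangle$ denotes the subgroup generated. The normalizer of a subgroup $S$ is $N(S)=\{(n,Y):(n,Y)S(n,Y)^{-1}=S\}$. *)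

theory Defs
  imports "HOL-Algebra.Group_Action" "HOL-Algebra.Elementary_Groups" "HOL-Number_Theory.Residues"
begin

section \<open>Autotopisms of a group\<close>

definition autotopisms :: "('a, 'b) monoid_scheme \<Rightarrow> (('a \<Rightarrow> 'a) \<times> ('a \<Rightarrow> 'a) \<times> ('a \<Rightarrow> 'a)) set" where
  "autotopisms G =
     {(\<alpha>, \<beta>, \<gamma>). \<alpha> \<in> Bij (carrier G) \<and> \<beta> \<in> Bij (carrier G) \<and> \<gamma> \<in> Bij (carrier G) \<and>
        (\<forall>x\<in>carrier G. \<forall>y\<in>carrier G. \<alpha> x \<otimes>\<^bsub>G\<^esub> \<beta> y = \<gamma> (x \<otimes>\<^bsub>G\<^esub> y))}"

definition Atp :: "('a, 'b) monoid_scheme \<Rightarrow> (('a \<Rightarrow> 'a) \<times> ('a \<Rightarrow> 'a) \<times> ('a \<Rightarrow> 'a)) monoid" where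
  "Atp G = (BijGroup (carrier G) \<times>\<times> BijGroup (carrier G) \<times>\<times> BijGroup (carrier G))
             \<lparr>carrier := autotopisms G\<rparr>"

section \<open>The semidirect product of the units of the integers mod p with the plane\<close>

definition Zp :: "nat \<Rightarrow> int monoid" where
  "Zp p = add_monoid (residue_ring (int p))"

definition Zp_star :: "nat \<Rightarrow> int monoid" where
  "Zp_star p = units_of (residue_ring (int p))"

definition Zp2 :: "nat \<Rightarrow> (int \<times> int) monoid" where
  "Zp2 p = Zp p \<times>\<times> Zp p"

definition scale :: "nat \<Rightarrow> int \<Rightarrow> int \<times> int \<Rightarrow> int \<times> int" where
  "scale p a = (\<lambda>(x, y). (a \<otimes>\<^bsub>residue_ring (int p)\<^esub> x, a \<otimes>\<^bsub>residue_ring (int p)\<^esub> y))"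

text \<open>With this underlying set, the subgroup \<open>H \<ltimes> Q\<close> is the Cartesian product \<open>H \<times> Q\<close>.\<close>

definition AutZp2 :: "nat \<Rightarrow> (int \<times> int \<times> int) monoid" where
  "AutZp2 p =
     \<lparr>carrier = carrier (Zp_star p) \<times> carrier (Zp2 p),
      monoid.mult = (\<lambda>(h, v) (h', v'). (h \<otimes>\<^bsub>Zp_star p\<^esub> h', scale p h v' \<otimes>\<^bsub>Zp2 p\<^esub> v)),
      one = (\<one>\<^bsub>Zp_star p\<^esub>, \<one>\<^bsub>Zp2 p\<^esub>)\<rparr>"

lemma group_Zp2:
  assumes "prime p" shows "group (Zp2 p)"
proof -
  interpret residues_prime p "residue_ring (int p)"
    by (rule residues_prime.intro[OF assms]) simp
  show ?thesis
    unfolding Zp2_def Zp_def by (intro DirProd_group add.is_group)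
qed

lemma group_AutZp2:
  assumes "prime p" shows "group (AutZp2 p)"
proof -
  interpret residues_prime p "residue_ring (int p)"
    by (rule residues_prime.intro[OF assms]) simp
  let ?R = "residue_ring (int p)"
  show ?thesis
  proof (rule groupI)
    fix x assume "x \<in> carrier (AutZp2 p)"
    then obtain h a b where x: "x = (h, a, b)" "h \<in> Units ?R" "a \<in> carrier ?R" "b \<in> carrier ?R"
      by (auto simp: AutZp2_def Zp_star_def units_of_def Zp2_def Zp_def)
    define k where "k = inv\<^bsub>?R\<^esub> h"
    have k: "k \<in> Units ?R" "k \<otimes>\<^bsub>?R\<^esub> h = \<one>\<^bsub>?R\<^esub>" "k \<in> carrier ?R"
      using x by (auto simp: k_def Units_inv_Units Units_l_inv Units_inv_closed)
    show "\<exists>y\<in>carrier (AutZp2 p). y \<otimes>\<^bsub>AutZp2 p\<^esub> x = \<one>\<^bsub>AutZp2 p\<^esub>"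
      by (rule bexI[of _ "(k, \<ominus>\<^bsub>?R\<^esub> (k \<otimes>\<^bsub>?R\<^esub> a), \<ominus>\<^bsub>?R\<^esub> (k \<otimes>\<^bsub>?R\<^esub> b))"])
        (use x k in \<open>auto simp: AutZp2_def Zp_star_def units_of_def Zp2_def Zp_def scale_def r_neg\<close>)
  qed (auto simp: AutZp2_def Zp_star_def units_of_def Zp2_def Zp_def scale_def
        Units_closed m_assoc r_distr a_assoc)
qed

definition mult_map :: "nat \<Rightarrow> int \<Rightarrow> int \<Rightarrow> int" where
  "mult_map p h = (\<lambda>x\<in>carrier (Zp p). h \<otimes>\<^bsub>residue_ring (int p)\<^esub> x)"

definition affine_map :: "nat \<Rightarrow> int \<Rightarrow> int \<Rightarrow> int \<Rightarrow> int" where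
  "affine_map p h c =
     (\<lambda>x\<in>carrier (Zp p). (h \<otimes>\<^bsub>residue_ring (int p)\<^esub> x) \<oplus>\<^bsub>residue_ring (int p)\<^esub> c)"

definition to_autotopism ::
    "nat \<Rightarrow> int \<times> int \<times> int \<Rightarrow> (int \<Rightarrow> int) \<times> (int \<Rightarrow> int) \<times> (int \<Rightarrow> int)" where
  "to_autotopism p = (\<lambda>(h, x0, y0).
     (affine_map p h x0, affine_map p h y0, affine_map p h (x0 \<oplus>\<^bsub>residue_ring (int p)\<^esub> y0)))"

definition conjugate_in :: "('a, 'b) monoid_scheme \<Rightarrow> 'a set \<Rightarrow> 'a set \<Rightarrow> bool" where
  "conjugate_in G K S \<longleftrightarrow>
     (\<exists>g\<in>carrier G. K = g <#\<^bsub>G\<^esub> S #>\<^bsub>G\<^esub> inv\<^bsub>G\<^esub> g)"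

section \<open>The list of representatives\<close>

definition H_sub :: "nat \<Rightarrow> int \<Rightarrow> nat \<Rightarrow> int set" where
  "H_sub p m0 d = generate (Zp_star p) {m0 [^]\<^bsub>Zp_star p\<^esub> d}"

definition line :: "nat \<Rightarrow> int \<times> int \<Rightarrow> (int \<times> int) set" where
  "line p v = generate (Zp2 p) {v}"

text \<open>One constructor for each family; the arguments are the parameters \<open>d\<close> and \<open>y\<close>.\<close>

datatype rep =
    Rep_trivial
  | Rep_line int
  | Rep_vertical
  | Rep_H nat
  | Rep_H_line nat int
  | Rep_H_vertical nat
  | Rep_H_plane nat

fun valid_rep :: "nat \<Rightarrow> rep \<Rightarrow> bool" where
  "valid_rep p Rep_trivial \<longleftrightarrow> True"
| "valid_rep p (Rep_line y) \<longleftrightarrow> y \<in> carrier (Zp p)"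
| "valid_rep p Rep_vertical \<longleftrightarrow> True"
| "valid_rep p (Rep_H d) \<longleftrightarrow> d dvd p - 1 \<and> d \<noteq> p - 1"
| "valid_rep p (Rep_H_line d y) \<longleftrightarrow> d dvd p - 1 \<and> d \<noteq> p - 1 \<and> y \<in> carrier (Zp p)"
| "valid_rep p (Rep_H_vertical d) \<longleftrightarrow> d dvd p - 1 \<and> d \<noteq> p - 1"
| "valid_rep p (Rep_H_plane d) \<longleftrightarrow> d dvd p - 1"

fun rep_subgroup :: "nat \<Rightarrow> int \<Rightarrow> rep \<Rightarrow> (int \<times> int \<times> int) set" where
  "rep_subgroup p m0 Rep_trivial = {1} \<times> {(0, 0)}"
| "rep_subgroup p m0 (Rep_line y) = {1} \<times> line p (1, y)"
| "rep_subgroup p m0 Rep_vertical = {1} \<times> line p (0, 1)"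
| "rep_subgroup p m0 (Rep_H d) = H_sub p m0 d \<times> {(0, 0)}"
| "rep_subgroup p m0 (Rep_H_line d y) = H_sub p m0 d \<times> line p (1, y)"
| "rep_subgroup p m0 (Rep_H_vertical d) = H_sub p m0 d \<times> line p (0, 1)"
| "rep_subgroup p m0 (Rep_H_plane d) = H_sub p m0 d \<times> carrier (Zp2 p)"

definition normalizer_scalar :: "nat \<Rightarrow> int \<Rightarrow> nat \<Rightarrow> int" where
  "normalizer_scalar p m0 d =
     (let R = residue_ring (int p) in inv\<^bsub>R\<^esub> (\<one>\<^bsub>R\<^esub> \<ominus>\<^bsub>R\<^esub> m0 [^]\<^bsub>R\<^esub> d))"

fun rep_normalizer :: "nat \<Rightarrow> int \<Rightarrow> rep \<Rightarrow> (int \<times> int \<times> int) set" where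
  "rep_normalizer p m0 Rep_trivial = carrier (AutZp2 p)"
| "rep_normalizer p m0 (Rep_line y) = carrier (AutZp2 p)"
| "rep_normalizer p m0 Rep_vertical = carrier (AutZp2 p)"
| "rep_normalizer p m0 (Rep_H d) = carrier (Zp_star p) \<times> {(0, 0)}"
| "rep_normalizer p m0 (Rep_H_line d y) =
     carrier (Zp_star p) \<times> line p (scale p (normalizer_scalar p m0 d) (1, y))"
| "rep_normalizer p m0 (Rep_H_vertical d) =
     carrier (Zp_star p) \<times> line p (scale p (normalizer_scalar p m0 d) (0, 1))"
| "rep_normalizer p m0 (Rep_H_plane d) = carrier (AutZp2 p)"

end

theory Submission
  imports Defs
begin

text \<open>
  Conjugation by \<open>(k, u)\<close> sends \<open>(h, x)\<close> to \<open>(h, k x + (1 - h) u)\<close>. Given a subgroup \<open>K\<close>, let \<open>H\<close> be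
  its image in \<open>\<int>\<^sub>p\<^sup>*\<close> and \<open>Q\<close> the set of its translations; \<open>Q\<close> is a linear subspace because
  every additive subgroup of the plane is. If \<open>(h\<^sub>0, v\<^sub>0) \<in> K\<close> with \<open>h\<^sub>0 \<noteq> 1\<close> and
  \<open>u = (1 - h\<^sub>0)\<inverse> v\<^sub>0\<close>, then for \<open>(h, v) \<in> K\<close> the commutator of \<open>(h\<^sub>0, v\<^sub>0)\<close> and \<open>(h, v)\<close> is
  the translation by \<open>(h\<^sub>0 - 1) (v - (1 - h) u)\<close>, so \<open>v - (1 - h) u \<in> Q\<close>, and hence
  \<open>K\<close> is the conjugate of \<open>H \<times> Q\<close> by \<open>(1, u)\<close>. Both \<open>H\<close> and \<open>Q\<close> are invariants of the conjugacy
  class, which reduces the classification to that of subgroups of the cyclic group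
  \<open>\<int>\<^sub>p\<^sup>*\<close> and of subspaces of the plane; and \<open>(k, u)\<close> normalizes \<open>H \<times> Q\<close> iff
  \<open>(1 - h) u \<in> Q\<close> for all \<open>h \<in> H\<close>.
\<close>

section \<open>Groups\<close>

lemma (in group) conjugate_set_eq_image:
  assumes "g \<in> carrier G" "S \<subseteq> carrier G"
  shows "g <# S #> inv g = (\<lambda>s. g \<otimes> s \<otimes> inv g) ` S"
  by (auto simp: l_coset_def r_coset_def)

section \<open>Subgroups of a finite cyclic group\<close>

lemma (in group) ord_generator:
  assumes "a \<in> carrier G" "generate G {a} = carrier G"
  shows "ord a = order G"
  using assms generate_pow_card by (simp add: order_def)

lemma (in group) card_generate_generator_pow:
  assumes "finite (carrier G)" "a \<in> carrier G" "generate G {a} = carrier G" "d dvd order G"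
  shows "card (generate G {a [^] d}) = order G div d"
proof -
  have "d \<noteq> 0"
    using assms order_gt_0_iff_finite by (metis dvd_0_left_iff less_irrefl)
  then show ?thesis
    using assms by (metis generate_pow_card nat_pow_closed ord_generator ord_pow)
qed

text \<open>With \<open>m\<close> the order of \<open>H\<close> and \<open>d * m\<close> the order
  of the group, any \<open>a [^] k\<close> in \<open>H\<close> satisfies
  \<open>a [^] (k * m) = \<one>\<close>. Hence \<open>d * m\<close> divides \<open>k * m\<close>, so
  \<open>d\<close> divides \<open>k\<close>, and \<open>H\<close> lies in the subgroup generated by
  \<open>a [^] d\<close>. That subgroup also has \<open>m\<close> elements.\<close>

lemma (in group) subgroup_eq_generate_pow:
  assumes fin: "finite (carrier G)" and a: "a \<in> carrier G" "generate G {a} = carrier G"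
    and H: "subgroup H G"
  obtains d where "d dvd order G" "H = generate G {a [^] d}"
proof -
  define m where "m = card H"
  define d where "d = order G div m"
  have m_dvd: "m dvd order G"
    unfolding m_def using lagrange[OF H] by (metis dvd_triv_right)
  have order_pos: "order G > 0"
    using fin order_gt_0_iff_finite by blast
  then have n: "order G = d * m" "m > 0"
    using m_dvd by (auto simp: d_def intro!: Nat.gr0I)
  interpret S: group "G\<lparr>carrier := H\<rparr>"
    using H by (rule subgroup_imp_group)
  have "H \<subseteq> generate G {a [^] d}"
  proof
    fix h assume h: "h \<in> H"
    then have hG: "h \<in> carrier G"
      using H subgroup.mem_carrier by fast
    then obtain k :: nat where k: "h = a [^] k"
      using a generate_pow_on_finite_carrier[OF fin a(1)] by auto
    have "h [^] m = \<one>"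
      using S.pow_order_eq_1[of h] h nat_pow_consistent by (simp add: order_def m_def)
    then have "order G dvd k * m"
      using k a by (metis nat_pow_pow ord_generator pow_eq_id)
    then have "d dvd k"
      using n by simp
    then obtain j where "k = d * j" by blast
    then have "h = (a [^] d) [^] j"
      using k a by (simp add: nat_pow_pow)
    then show "h \<in> generate G {a [^] d}"
      using generate_pow_on_finite_carrier[OF fin, of "a [^] d"] a by auto
  qed
  moreover have "card (generate G {a [^] d}) = card H"
    using card_generate_generator_pow[OF fin a, of d] n order_pos by (simp add: m_def)
  moreover have "finite (generate G {a [^] d})"
    using fin a by (intro finite_subset[OF generate_incl]) auto
  ultimately have "H = generate G {a [^] d}"
    by (metis card_subset_eq)
  then show thesis
    using that[of d] n(1) by (metis dvd_triv_left)
qed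

section \<open>Arithmetic in the semidirect product\<close>

text \<open>The shape in which inner reductions are stripped when affine maps are composed or their
  values are added.\<close>

lemma mod_mult_add_eq: "(h * (x mod m) + c) mod m = (h * x + c) mod (m :: int)"
  by (metis mod_add_left_eq mod_mult_right_eq)

section \<open>Group operations as integer arithmetic modulo \<open>p\<close>\<close>

lemma carrier_Zp [simp]: "carrier (Zp p) = {0..<int p}"
  by (auto simp: Zp_def residue_ring_def)

lemma mult_Zp [simp]: "x \<otimes>\<^bsub>Zp p\<^esub> y = (x + y) mod int p"
  by (simp add: Zp_def residue_ring_def)

lemma one_Zp [simp]: "\<one>\<^bsub>Zp p\<^esub> = 0"
  by (simp add: Zp_def residue_ring_def)

lemma carrier_Zp2 [simp]: "carrier (Zp2 p) = {0..<int p} \<times> {0..<int p}"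
  by (simp add: Zp2_def)

lemma mult_Zp2 [simp]:
  "(x, y) \<otimes>\<^bsub>Zp2 p\<^esub> (x', y') = ((x + x') mod int p, (y + y') mod int p)"
  by (simp add: Zp2_def)

lemma one_Zp2 [simp]: "\<one>\<^bsub>Zp2 p\<^esub> = (0, 0)"
  by (simp add: Zp2_def)

lemma mult_Zp_star [simp]: "x \<otimes>\<^bsub>Zp_star p\<^esub> y = x * y mod int p"
  by (simp add: Zp_star_def units_of_def residue_ring_def)

lemma one_Zp_star [simp]: "\<one>\<^bsub>Zp_star p\<^esub> = 1"
  by (simp add: Zp_star_def units_of_def residue_ring_def)

lemma scale_pair [simp]: "scale p a (x, y) = (a * x mod int p, a * y mod int p)"
  by (simp add: scale_def residue_ring_def)

lemma mult_AutZp2 [simp]: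
  "(h, x, y) \<otimes>\<^bsub>AutZp2 p\<^esub> (h', x', y') =
     (h * h' mod int p, (h * x' + x) mod int p, (h * y' + y) mod int p)"
  by (simp add: AutZp2_def mod_simps)

lemma one_AutZp2 [simp]: "\<one>\<^bsub>AutZp2 p\<^esub> = (1, 0, 0)"
  by (simp add: AutZp2_def)

context
  fixes p :: nat
  assumes prime_p: "prime p"
begin

interpretation residues_prime p "residue_ring (int p)"
  by (rule residues_prime.intro[OF prime_p]) simp

lemma p_gt_1: "int p > 1"
  using prime_p prime_gt_1_nat by auto

lemma carrier_Zp_star: "carrier (Zp_star p) = {1..<int p}"
proof -
  have "carrier (Zp_star p) = {1..int (p - 1)}"
    by (simp only: Zp_star_def units_of_carrier res_prime_units_eq)
  also have "int (p - 1) = int p - 1"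
    using p_gt_1 by linarith
  also have "{1..int p - 1} = {1..<int p}"
    by auto
  finally show ?thesis .
qed

lemma carrier_AutZp2: "carrier (AutZp2 p) = {1..<int p} \<times> {0..<int p} \<times> {0..<int p}"
  by (simp add: AutZp2_def carrier_Zp_star)

lemma group_Zp_star: "group (Zp_star p)"
  unfolding Zp_star_def by (rule units_group)

lemma finite_Zp_star: "finite (carrier (Zp_star p))"
  by (simp add: carrier_Zp_star)

lemma order_Zp_star: "order (Zp_star p) = p - 1"
  by (simp add: order_def carrier_Zp_star nat_diff_distrib)

interpretation Zs: group "Zp_star p" by (rule group_Zp_star)
interpretation Z2: group "Zp2 p" by (rule group_Zp2[OF prime_p])
interpretation A: group "AutZp2 p" by (rule group_AutZp2[OF prime_p])

section \<open>Cyclicity and inverses modulo \<open>p\<close>\<close>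

lemma cyclic_Zp_star: "cyclic_group (Zp_star p)"
proof -
  \<comment> \<open>In a field the units are the nonzero elements, so the generator known for the
    multiplicative group of a finite field can be transferred to \<open>Zp_star p\<close>.\<close>
  have "mult_of (residue_ring (int p)) = units_of (residue_ring (int p))"
    by (rule mult_of_is_Units)
  then have eq: "Zp_star p = mult_of (residue_ring (int p))"
    by (simp add: Zp_star_def)
  obtain a where a: "a \<in> carrier (Zp_star p)"
     "carrier (Zp_star p) = {a [^]\<^bsub>residue_ring (int p)\<^esub> i | i::nat. i \<in> UNIV}"
    using finite_field_mult_group_has_gen[OF local.finite] unfolding eq[symmetric] by blast
  have "x \<in> range (\<lambda>n::int. a [^]\<^bsub>Zp_star p\<^esub> n)" if x: "x \<in> carrier (Zp_star p)" for x
  proof -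
    obtain i :: nat where "x = a [^]\<^bsub>residue_ring (int p)\<^esub> i"
      using x[unfolded a(2)] by blast
    then have "x = a [^]\<^bsub>Zp_star p\<^esub> int i"
      by (simp add: eq nat_pow_mult_of int_pow_int)
    then show ?thesis by blast
  qed
  moreover have "range (\<lambda>n::int. a [^]\<^bsub>Zp_star p\<^esub> n) \<subseteq> carrier (Zp_star p)"
    using a(1) by blast
  ultimately show ?thesis
    unfolding Zs.cyclic_group using a(1) by blast
qed

text \<open>A Bezout coefficient is an inverse. Its residue is still an inverse, and cannot be 0
  because the product would then be 0 instead of 1.\<close>

lemma inverse_mod_ex:
  fixes a :: int
  assumes "\<not> int p dvd a"
  obtains b where "b * a mod int p = 1" "b \<in> {1..<int p}"
proof -
  have "coprime a (int p)"
    using assms prime_p p_coprime_right_int by blast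
  then obtain b where b: "[a * b = 1] (mod int p)"
    using cong_solve_coprime_int by blast
  then have "b * a mod int p = 1"
    using p_gt_1 by (simp add: cong_def mult.commute)
  then have b': "(b mod int p) * a mod int p = 1"
    by (simp add: mod_simps)
  then have "b mod int p \<noteq> 0"
    using p_gt_1 by (metis mod_0 mult_zero_left zero_neq_one)
  with b' p_gt_1 show thesis
    using that[of "b mod int p"]
    by (metis atLeastLessThan_iff int_one_le_iff_zero_less less_le_trans pos_mod_bound pos_mod_sign zero_less_one order_less_le)
qed

lemma not_dvd_residue:
  assumes "a \<in> {1..<int p}"
  shows "\<not> int p dvd a"
  using assms zdvd_not_zless by auto

section \<open>Automorphisms and autotopisms of the integers mod \<open>p\<close>\<close>

lemma affine_map_eq: "affine_map p h c = (\<lambda>x\<in>{0..<int p}. (h * x + c) mod int p)"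
  unfolding affine_map_def carrier_Zp by (simp add: res_mult_eq res_add_eq mod_simps)

lemma mult_map_eq: "mult_map p h = affine_map p h 0"
  unfolding affine_map_eq mult_map_def carrier_Zp by (rule ext) (simp add: restrict_def res_mult_eq)

lemma to_autotopism_eq:
  "to_autotopism p (h, u, v) =
    (affine_map p h u, affine_map p h v, affine_map p h ((u + v) mod int p))"
  by (simp add: to_autotopism_def res_add_eq)

text \<open>The slope is prime to \<open>p\<close> and can be cancelled, which gives injectivity; an
  injective self-map of a finite set is onto.\<close>

lemma affine_map_Bij:
  assumes h: "h \<in> {1..<int p}"
  shows "affine_map p h c \<in> Bij {0..<int p}"
proof -
  have "inj_on (affine_map p h c) {0..<int p}"
  proof (rule inj_onI)
    fix x y
    assume xy: "x \<in> {0..<int p}" "y \<in> {0..<int p}" "affine_map p h c x = affine_map p h c y"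
    then have "(h * x + c) mod int p = (h * y + c) mod int p"
      by (simp add: affine_map_eq)
    then have "int p dvd h * (x - y)"
      by (simp add: mod_eq_dvd_iff algebra_simps)
    moreover have "prime (int p)"
      using prime_p by simp
    ultimately have "int p dvd x - y"
      using not_dvd_residue[OF h] prime_dvd_mult_iff by blast
    then have "x mod int p = y mod int p"
      by (simp add: mod_eq_dvd_iff)
    then show "x = y"
      using xy by simp
  qed
  moreover have "affine_map p h c ` {0..<int p} \<subseteq> {0..<int p}"
    using p_gt_1 by (auto simp: affine_map_eq)
  ultimately have "bij_betw (affine_map p h c) {0..<int p} {0..<int p}"
    by (simp add: bij_betw_def endo_inj_surj)
  then show ?thesis
    by (simp add: Bij_def affine_map_eq)
qed

text \<open>This is the multiplication law of the semidirect product, seen in one coordinate of the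
  plane.\<close>

lemma affine_map_compose:
  "compose {0..<int p} (affine_map p h c) (affine_map p h' c') =
    affine_map p (h * h' mod int p) ((h * c' + c) mod int p)"
proof
  show "compose {0..<int p} (affine_map p h c) (affine_map p h' c') x =
    affine_map p (h * h' mod int p) ((h * c' + c) mod int p) x" for x
  proof (cases "x \<in> {0..<int p}")
    case True
    have "(h * ((h' * x + c') mod int p) + c) mod int p = (x * (h * h' mod int p) + (h * c' + c) mod int p) mod int p"
      by (simp only: mod_mult_add_eq mod_simps) (simp only: algebra_simps)
    then show ?thesis
      using True p_gt_1 by (simp add: compose_def affine_map_eq mult.commute)
  qed (auto simp: compose_def affine_map_eq)
qed

text \<open>The value at 0 determines the constant term, and then the value at 1 determines the
  slope.\<close>

lemma affine_map_inject:
  assumes eq: "affine_map p h c = affine_map p h' c'"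
    and c: "c \<in> {0..<int p}" "c' \<in> {0..<int p}"
    and h: "h \<in> {1..<int p}" "h' \<in> {1..<int p}"
  shows "h = h'" "c = c'"
proof -
  have x: "(h * x + c) mod int p = (h' * x + c') mod int p" if "x \<in> {0..<int p}" for x
    using fun_cong[OF eq, of x] that by (simp add: affine_map_eq)
  from x[of 0] show cc: "c = c'"
    using c p_gt_1 by simp
  from x[of 1] have "(h + c) mod int p = (h' + c) mod int p"
    using p_gt_1 cc by simp
  then have "h mod int p = h' mod int p"
    by (simp add: mod_eq_dvd_iff)
  then show "h = h'"
    using h by simp
qed

text \<open>The hypothesis says that \<open>f - f 0\<close> is additive, so induction from 0 gives
  slope \<open>f 1 - f 0\<close>. Injectivity makes the slope nonzero. Both automorphisms and
  components of autotopisms are handled by this lemma.\<close>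

lemma Bij_additive_imp_affine:
  assumes f: "f \<in> Bij {0..<int p}"
    and add: "\<And>x y. x \<in> {0..<int p} \<Longrightarrow> y \<in> {0..<int p} \<Longrightarrow>
      [f ((x + y) mod int p) + f 0 = f x + f y] (mod int p)"
  obtains h where "h \<in> {1..<int p}" "f = affine_map p h (f 0)"
proof -
  define h where "h = (f 1 - f 0) mod int p"
  have range: "f x \<in> {0..<int p}" if "x \<in> {0..<int p}" for x
    using that Bij_imp_funcset[OF f] by auto
  have inj: "inj_on f {0..<int p}"
    using f by (simp add: Bij_def bij_betw_def)
  have 01: "0 \<in> {0..<int p}" "1 \<in> {0..<int p}"
    using p_gt_1 by auto
  have nat_case: "[f (int n mod int p) = h * int n + f 0] (mod int p)" for n
  proof (induction n)
    case 0
    then show ?case by simp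
  next
    case (Suc n)
    have "int n mod int p \<in> {0..<int p}"
      using p_gt_1 by simp
    from add[OF this 01(2)]
    have "[f (int (Suc n) mod int p) + f 0 = f (int n mod int p) + f 1] (mod int p)"
      by (simp add: mod_simps add.commute)
    also have "[f (int n mod int p) + f 1 = (h * int n + f 0) + f 1] (mod int p)"
      using Suc by (rule cong_add[OF _ cong_refl])
    also have "[(h * int n + f 0) + f 1 = (h * int n + f 0) + (h + f 0)] (mod int p)"
      by (intro cong_add cong_refl) (simp add: h_def cong_def mod_simps)
    also have "(h * int n + f 0) + (h + f 0) = (h * int (Suc n) + f 0) + f 0"
      by (simp add: algebra_simps)
    \<comment> \<open>Both ends of the chain carry one extra \<open>f 0\<close>, which
      cancels.\<close>
    finally show ?case
      using cong_add_rcancel by blast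
  qed
  have "f = affine_map p h (f 0)"
  proof
    fix x
    show "f x = affine_map p h (f 0) x"
    proof (cases "x \<in> {0..<int p}")
      case True
      then show ?thesis
        using nat_case[of "nat x"] range[of x] by (simp add: affine_map_eq cong_def)
    next
      case False
      then show ?thesis
        using Bij_imp_extensional[OF f] by (auto simp: affine_map_eq extensional_def)
    qed
  qed
  moreover have "h \<noteq> 0"
  proof
    assume "h = 0"
    then have "f 1 mod int p = f 0 mod int p"
      by (simp add: h_def mod_eq_dvd_iff mod_eq_0_iff_dvd)
    then have "f 1 = f 0"
      using range[OF 01(1)] range[OF 01(2)] by simp
    then show False
      using inj_onD[OF inj _ 01(2) 01(1)] by simp
  qed
  moreover have "h \<in> {0..<int p}"
    using p_gt_1 by (simp add: h_def)
  ultimately show thesis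
    using that[of h] by simp
qed

lemma carrier_AutoGroup_Zp: "carrier (AutoGroup (Zp p)) =
  {f \<in> Bij {0..<int p}. \<forall>x\<in>{0..<int p}. \<forall>y\<in>{0..<int p}. f ((x + y) mod int p) = (f x + f y) mod int p}"
  using Bij_imp_funcset by (auto simp: AutoGroup_def auto_def hom_def)

lemma mult_map_iso: "mult_map p \<in> iso (Zp_star p) (AutoGroup (Zp p))"
proof -
  have closed: "mult_map p h \<in> carrier (AutoGroup (Zp p))" if "h \<in> carrier (Zp_star p)" for h
    using that affine_map_Bij[of h 0] p_gt_1
    by (simp add: carrier_AutoGroup_Zp mult_map_eq carrier_Zp_star)
      (simp add: affine_map_eq mod_simps algebra_simps)
  have "mult_map p \<in> hom (Zp_star p) (AutoGroup (Zp p))"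
  proof (rule homI)
    fix h k assume hk: "h \<in> carrier (Zp_star p)" "k \<in> carrier (Zp_star p)"
    then show "mult_map p (h \<otimes>\<^bsub>Zp_star p\<^esub> k) = mult_map p h \<otimes>\<^bsub>AutoGroup (Zp p)\<^esub> mult_map p k"
      using affine_map_Bij[of h 0] affine_map_Bij[of k 0] affine_map_compose[of h 0 k 0]
      by (simp add: AutoGroup_def BijGroup_def mult_map_eq carrier_Zp_star)
  qed (rule closed)
  moreover have "bij_betw (mult_map p) (carrier (Zp_star p)) (carrier (AutoGroup (Zp p)))"
  proof (rule bij_betw_imageI)
    show "inj_on (mult_map p) (carrier (Zp_star p))"
      using affine_map_inject(1)[of _ 0 _ 0] p_gt_1
      by (intro inj_onI) (simp add: mult_map_eq carrier_Zp_star)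
    have "f \<in> mult_map p ` carrier (Zp_star p)" if f: "f \<in> carrier (AutoGroup (Zp p))" for f
    proof -
      have f': "f \<in> Bij {0..<int p}"
        "\<And>x y. x \<in> {0..<int p} \<Longrightarrow> y \<in> {0..<int p} \<Longrightarrow>
          f ((x + y) mod int p) = (f x + f y) mod int p"
        using f by (simp_all add: carrier_AutoGroup_Zp)
      have 0: "0 \<in> {0..<int p}"
        using p_gt_1 by simp
      have r: "f 0 mod int p = f 0"
        using funcset_mem[OF Bij_imp_funcset[OF f'(1)] 0] by simp
      \<comment> \<open>Additivity at (0, 0) forces \<open>f 0 = 0\<close>, so the affine form of
        \<open>f\<close> has no constant term and \<open>f\<close> is a multiplication.\<close>
      have "(f 0 + f 0) mod int p = f 0"
        using f'(2)[OF 0 0] by simp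
      then have "[f 0 + f 0 = 0 + f 0] (mod int p)"
        by (simp only: cong_def add_0 r)
      then have "[f 0 = 0] (mod int p)"
        using cong_add_rcancel by blast
      then have "f 0 = 0"
        using r by (simp add: cong_def)
      moreover obtain h where "h \<in> {1..<int p}" "f = affine_map p h (f 0)"
        using Bij_additive_imp_affine[OF f'(1)] f'(2) \<open>f 0 = 0\<close> by (auto simp: cong_def)
      ultimately show ?thesis
        by (intro image_eqI[of _ _ h]) (simp_all add: mult_map_eq carrier_Zp_star)
    qed
    then show "mult_map p ` carrier (Zp_star p) = carrier (AutoGroup (Zp p))"
      using closed by blast
  qed
  ultimately show ?thesis
    by (simp add: iso_def)
qed

lemma carrier_Atp_Zp: "carrier (Atp (Zp p)) =
  {(\<alpha>, \<beta>, \<gamma>). \<alpha> \<in> Bij {0..<int p} \<and> \<beta> \<in> Bij {0..<int p} \<and> \<gamma> \<in> Bij {0..<int p} \<and>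
    (\<forall>x\<in>{0..<int p}. \<forall>y\<in>{0..<int p}. (\<alpha> x + \<beta> y) mod int p = \<gamma> ((x + y) mod int p))}"
  by (simp add: Atp_def autotopisms_def)

text \<open>Setting one argument to 0 shows that \<gamma> is \<alpha> plus the constant \<beta>(0),
  and also \<beta> plus the constant \<alpha>(0). Substituting this back makes \<alpha> affine, and
  the other two components then share its slope.\<close>

lemma autotopism_Zp_affine:
  assumes "(\<alpha>, \<beta>, \<gamma>) \<in> carrier (Atp (Zp p))"
  obtains h u v where "(h, u, v) \<in> carrier (AutZp2 p)" "(\<alpha>, \<beta>, \<gamma>) = to_autotopism p (h, u, v)"
proof -
  have \<alpha>: "\<alpha> \<in> Bij {0..<int p}" and \<beta>: "\<beta> \<in> Bij {0..<int p}" and \<gamma>: "\<gamma> \<in> Bij {0..<int p}"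
    and eq: "\<And>x y. x \<in> {0..<int p} \<Longrightarrow> y \<in> {0..<int p} \<Longrightarrow>
      \<gamma> ((x + y) mod int p) = (\<alpha> x + \<beta> y) mod int p"
    using assms by (simp_all add: carrier_Atp_Zp)
  have 0: "0 \<in> {0..<int p}"
    using p_gt_1 by simp
  have range: "\<alpha> x \<in> {0..<int p}" "\<beta> x \<in> {0..<int p}" if "x \<in> {0..<int p}" for x
    using that Bij_imp_funcset[OF \<alpha>] Bij_imp_funcset[OF \<beta>] by auto
  have \<gamma>\<alpha>: "\<gamma> x = (\<alpha> x + \<beta> 0) mod int p" if "x \<in> {0..<int p}" for x
    using eq[OF that 0] that by simp
  have \<gamma>\<beta>: "\<gamma> x = (\<alpha> 0 + \<beta> x) mod int p" if "x \<in> {0..<int p}" for x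
    using eq[OF 0 that] that by simp
  have add: "[\<alpha> ((x + y) mod int p) + \<alpha> 0 = \<alpha> x + \<alpha> y] (mod int p)"
    if xy: "x \<in> {0..<int p}" "y \<in> {0..<int p}" for x y
  proof -
    have s: "(x + y) mod int p \<in> {0..<int p}"
      using p_gt_1 by simp
    have 1: "[\<alpha> ((x + y) mod int p) + \<beta> 0 = \<alpha> x + \<beta> y] (mod int p)"
      using \<gamma>\<alpha>[OF s] eq[OF xy] by (simp add: cong_def)
    have 2: "[\<alpha> 0 + \<beta> y = \<alpha> y + \<beta> 0] (mod int p)"
      using \<gamma>\<alpha>[OF xy(2)] \<gamma>\<beta>[OF xy(2)] by (simp add: cong_def)
    \<comment> \<open>The terms in \<beta> were collected on both sides so that they cancel and a
      condition on \<alpha> alone remains.\<close>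
    have "[(\<alpha> ((x + y) mod int p) + \<alpha> 0) + (\<beta> 0 + \<beta> y) = (\<alpha> x + \<alpha> y) + (\<beta> 0 + \<beta> y)] (mod int p)"
      using cong_add[OF 1 2] by (simp add: ac_simps)
    then show ?thesis
      using cong_add_rcancel by blast
  qed
  obtain h where h: "h \<in> {1..<int p}" "\<alpha> = affine_map p h (\<alpha> 0)"
    using Bij_additive_imp_affine[OF \<alpha> add] by blast
  have \<alpha>_eq: "\<alpha> x = (h * x + \<alpha> 0) mod int p" if "x \<in> {0..<int p}" for x
    using fun_cong[OF h(2), of x] that by (simp add: affine_map_eq)
  have "\<beta> = affine_map p h (\<beta> 0)"
  proof
    fix x
    show "\<beta> x = affine_map p h (\<beta> 0) x"
    proof (cases "x \<in> {0..<int p}")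
      case x: True
      have "[\<alpha> 0 + \<beta> x = \<alpha> x + \<beta> 0] (mod int p)"
        using \<gamma>\<alpha>[OF x] \<gamma>\<beta>[OF x] by (simp add: cong_def)
      also have "[\<alpha> x + \<beta> 0 = \<alpha> 0 + (h * x + \<beta> 0)] (mod int p)"
        using \<alpha>_eq[OF x] by (simp add: cong_def mod_simps ac_simps)
      finally have "[\<beta> x = h * x + \<beta> 0] (mod int p)"
        using cong_add_lcancel by blast
      then show ?thesis
        using x range(2)[OF x] by (simp add: affine_map_eq cong_def)
    next
      case False
      then show ?thesis
        using Bij_imp_extensional[OF \<beta>] by (auto simp: affine_map_eq extensional_def)
    qed
  qed
  moreover have "\<gamma> = affine_map p h ((\<alpha> 0 + \<beta> 0) mod int p)"
  proof
    fix x
    show "\<gamma> x = affine_map p h ((\<alpha> 0 + \<beta> 0) mod int p) x"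
    proof (cases "x \<in> {0..<int p}")
      case x: True
      then show ?thesis
        using \<gamma>\<alpha>[OF x] \<alpha>_eq[OF x] by (simp add: affine_map_eq mod_simps ac_simps)
    next
      case False
      then show ?thesis
        using Bij_imp_extensional[OF \<gamma>] by (auto simp: affine_map_eq extensional_def)
    qed
  qed
  ultimately have "(\<alpha>, \<beta>, \<gamma>) = to_autotopism p (h, \<alpha> 0, \<beta> 0)"
    using h(2) unfolding to_autotopism_eq by blast
  moreover have "(h, \<alpha> 0, \<beta> 0) \<in> carrier (AutZp2 p)"
    using h(1) range[OF 0] by (simp add: carrier_AutZp2)
  ultimately show thesis
    using that by blast
qed

lemma to_autotopism_iso: "to_autotopism p \<in> iso (AutZp2 p) (Atp (Zp p))"
proof -
  have closed: "to_autotopism p g \<in> carrier (Atp (Zp p))" if g: "g \<in> carrier (AutZp2 p)" for g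
  proof -
    obtain h u v where huv: "g = (h, u, v)"
      by (cases g)
    then have "h \<in> {1..<int p}"
      using g by (simp add: carrier_AutZp2)
    moreover have "(affine_map p h u x + affine_map p h v y) mod int p =
        affine_map p h ((u + v) mod int p) ((x + y) mod int p)"
      if "x \<in> {0..<int p}" "y \<in> {0..<int p}" for x y
    proof -
      have "((h * x + u) mod int p + (h * y + v) mod int p) mod int p =
          (h * ((x + y) mod int p) + (u + v) mod int p) mod int p"
        by (simp only: mod_mult_add_eq mod_simps) (simp only: algebra_simps)
      then show ?thesis
        using that p_gt_1 by (simp add: affine_map_eq)
    qed
    ultimately show ?thesis
      unfolding huv to_autotopism_eq carrier_Atp_Zp using affine_map_Bij by simp
  qed
  have "to_autotopism p \<in> hom (AutZp2 p) (Atp (Zp p))"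
  proof (rule homI)
    fix g k assume gk: "g \<in> carrier (AutZp2 p)" "k \<in> carrier (AutZp2 p)"
    obtain h u v h' u' v' where eq: "g = (h, u, v)" "k = (h', u', v')"
      by (cases g, cases k)
    then have "h \<in> {1..<int p}" "h' \<in> {1..<int p}"
      using gk by (simp_all add: carrier_AutZp2)
    then have comp: "affine_map p h c \<otimes>\<^bsub>BijGroup (carrier (Zp p))\<^esub> affine_map p h' c' =
        affine_map p (h * h' mod int p) ((h * c' + c) mod int p)" for c c'
      using affine_map_Bij affine_map_compose by (simp add: BijGroup_def)
    \<comment> \<open>The third component of the product has as its constant the sum of the
      constants of the first two; it has to agree with the composition of the third
      components.\<close>
    have "((h * u' + u) mod int p + (h * v' + v) mod int p) mod int p =
        (h * ((u' + v') mod int p) + (u + v) mod int p) mod int p"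
      by (simp only: mod_mult_add_eq mod_simps) (simp only: algebra_simps)
    then show "to_autotopism p (g \<otimes>\<^bsub>AutZp2 p\<^esub> k) =
        to_autotopism p g \<otimes>\<^bsub>Atp (Zp p)\<^esub> to_autotopism p k"
      unfolding eq mult_AutZp2 to_autotopism_eq by (simp del: carrier_Zp add: Atp_def comp)
  qed (rule closed)
  moreover have "bij_betw (to_autotopism p) (carrier (AutZp2 p)) (carrier (Atp (Zp p)))"
  proof (rule bij_betw_imageI)
    show "inj_on (to_autotopism p) (carrier (AutZp2 p))"
    proof (rule inj_onI)
      fix g k assume gk: "g \<in> carrier (AutZp2 p)" "k \<in> carrier (AutZp2 p)"
        "to_autotopism p g = to_autotopism p k"
      obtain h u v h' u' v' where eq: "g = (h, u, v)" "k = (h', u', v')"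
        by (cases g, cases k)
      have "affine_map p h u = affine_map p h' u'" "affine_map p h v = affine_map p h' v'"
        using gk(3) by (simp_all add: eq to_autotopism_eq)
      then have "h = h'" "u = u'" "v = v'"
        using gk(1,2) affine_map_inject[of h u h' u'] affine_map_inject[of h v h' v']
        by (simp_all add: eq carrier_AutZp2)
      then show "g = k"
        by (simp add: eq)
    qed
    have "t \<in> to_autotopism p ` carrier (AutZp2 p)" if "t \<in> carrier (Atp (Zp p))" for t
      using that autotopism_Zp_affine by (cases t) blast
    then show "to_autotopism p ` carrier (AutZp2 p) = carrier (Atp (Zp p))"
      using closed by blast
  qed
  ultimately show ?thesis
    by (simp add: iso_def)
qed

section \<open>Subgroups of the plane\<close>

text \<open>Modulo \<open>p\<close> every scalar is a natural number, and scaling by a natural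
  number is repeated addition. Additive subgroups of the plane are therefore linear
  subspaces.\<close>

lemma scale_mem:
  assumes Q: "subgroup Q (Zp2 p)" and v: "(x, y) \<in> Q"
  shows "(a * x mod int p, a * y mod int p) \<in> Q"
proof -
  have nat_case: "(int n * x mod int p, int n * y mod int p) \<in> Q" for n
  proof (induction n)
    case 0
    then show ?case
      using subgroup.one_closed[OF Q] by simp
  next
    case (Suc n)
    then show ?case
      using subgroup.m_closed[OF Q Suc v] by (simp add: mod_simps algebra_simps)
  qed
  have "int (nat (a mod int p)) = a mod int p"
    using p_gt_1 by simp
  then show ?thesis
    using nat_case[of "nat (a mod int p)"] by (simp add: mod_simps)
qed

lemma scale_cancel:
  assumes Q: "subgroup Q (Zp2 p)" and "\<not> int p dvd a"
    and "(a * x mod int p, a * y mod int p) \<in> Q"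
  shows "(x mod int p, y mod int p) \<in> Q"
proof -
  obtain b where b: "b * a mod int p = 1"
    using inverse_mod_ex[OF assms(2)] by blast
  have "b * (a * x) mod int p = x mod int p" for x
    using b by (metis mod_mult_left_eq mult.assoc mult_1)
  then show ?thesis
    using scale_mem[OF Q assms(3), of b] by (simp add: mod_simps)
qed

text \<open>The coordinates need not be reduced, so linear combinations can be assembled first and
  reduced at the end.\<close>

lemma add_mem:
  assumes "subgroup Q (Zp2 p)" "(x mod int p, y mod int p) \<in> Q" "(x' mod int p, y' mod int p) \<in> Q"
  shows "((x + x') mod int p, (y + y') mod int p) \<in> Q"
  using subgroup.m_closed[OF assms] by (simp add: mod_simps)

lemma mod_residue:
  assumes "subgroup Q (Zp2 p)" "(x, y) \<in> Q"
  shows "x mod int p = x" "y mod int p = y" "0 \<le> x" "x < int p" "0 \<le> y" "y < int p"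
  using subgroup.subset[OF assms(1)] assms(2) by auto

lemma inv_Zp2:
  assumes "(x, y) \<in> carrier (Zp2 p)"
  shows "inv\<^bsub>Zp2 p\<^esub> (x, y) = (- x mod int p, - y mod int p)"
  using assms p_gt_1 by (intro Z2.inv_equality) (auto simp: mod_simps)

text \<open>The multiples of a vector form a subgroup containing it, and by \<open>scale_mem\<close>
  they lie in every subgroup that contains it.\<close>

lemma line_eq:
  assumes "(x, y) \<in> carrier (Zp2 p)"
  shows "line p (x, y) = range (\<lambda>a. (a * x mod int p, a * y mod int p))"
proof
  let ?L = "range (\<lambda>a. (a * x mod int p, a * y mod int p))"
  have "subgroup ?L (Zp2 p)"
  proof (rule Z2.subgroupI)
    show "?L \<subseteq> carrier (Zp2 p)"
      using p_gt_1 by auto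
    show "inv\<^bsub>Zp2 p\<^esub> v \<in> ?L" if v: "v \<in> ?L" for v
    proof -
      obtain a where a: "v = (a * x mod int p, a * y mod int p)"
        using v by blast
      then have "inv\<^bsub>Zp2 p\<^esub> v = (- a * x mod int p, - a * y mod int p)"
        using inv_Zp2 p_gt_1 by (simp add: mod_simps)
      then show ?thesis by blast
    qed
    show "v \<otimes>\<^bsub>Zp2 p\<^esub> w \<in> ?L" if "v \<in> ?L" "w \<in> ?L" for v w
    proof -
      obtain a b where "v = (a * x mod int p, a * y mod int p)" "w = (b * x mod int p, b * y mod int p)"
        using \<open>v \<in> ?L\<close> \<open>w \<in> ?L\<close> by auto
      then have "v \<otimes>\<^bsub>Zp2 p\<^esub> w = ((a + b) * x mod int p, (a + b) * y mod int p)"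
        by (simp add: mod_simps algebra_simps)
      then show ?thesis by blast
    qed
  qed auto
  moreover have "(x, y) \<in> ?L"
    using assms by (auto intro!: range_eqI[of _ _ 1])
  ultimately show "line p (x, y) \<subseteq> ?L"
    unfolding line_def by (intro Z2.generate_subgroup_incl) auto
  have "subgroup (line p (x, y)) (Zp2 p)" "(x, y) \<in> line p (x, y)"
    unfolding line_def using assms by (auto intro: Z2.generate_is_subgroup generate.incl)
  then show "?L \<subseteq> line p (x, y)"
    using scale_mem by blast
qed

lemma subgroup_line: "v \<in> carrier (Zp2 p) \<Longrightarrow> subgroup (line p v) (Zp2 p)"
  unfolding line_def by (intro Z2.generate_is_subgroup) auto

lemma mem_line: "v \<in> line p v"
  unfolding line_def by (simp add: generate.incl)

lemma line_subset:
  assumes "subgroup Q (Zp2 p)" "v \<in> Q"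
  shows "line p v \<subseteq> Q"
  unfolding line_def using assms by (intro Z2.generate_subgroup_incl) auto

text \<open>Because of this, the factor \<open>normalizer_scalar\<close> in
  \<open>rep_normalizer\<close> does not change the line that it multiplies.\<close>

lemma line_scale:
  assumes "(x, y) \<in> carrier (Zp2 p)" "a \<in> {1..<int p}"
  shows "line p (scale p a (x, y)) = line p (x, y)"
proof
  have L: "subgroup (line p (x, y)) (Zp2 p)"
    by (rule subgroup_line[OF assms(1)])
  show "line p (scale p a (x, y)) \<subseteq> line p (x, y)"
    using scale_mem[OF L mem_line] by (intro line_subset[OF L]) simp
  have "subgroup (line p (scale p a (x, y))) (Zp2 p)"
    using p_gt_1 by (intro subgroup_line) simp
  then show "line p (x, y) \<subseteq> line p (scale p a (x, y))"
    using scale_cancel[of "line p (scale p a (x, y))" a x y] mem_line[of "scale p a (x, y)"]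
      not_dvd_residue assms by (intro line_subset) auto
qed

text \<open>A vector with nonzero first coordinate can be rescaled to (1, z). Either its line is all
  of \<open>Q\<close>, or a vector off the line yields (0, 1) and \<open>Q\<close> is the plane. If
  no such vector exists, \<open>Q\<close> is vertical: zero, or rescaled to contain (0, 1).\<close>

lemma subgroup_Zp2_cases:
  assumes Q: "subgroup Q (Zp2 p)"
  obtains "Q = {(0, 0)}" | y where "y \<in> {0..<int p}" "Q = line p (1, y)"
    | "Q = line p (0, 1)" | "Q = carrier (Zp2 p)"
proof (cases "\<exists>x y. x \<noteq> 0 \<and> (x, y) \<in> Q")
  case True
  then obtain x y where xy: "x \<noteq> 0" "(x, y) \<in> Q" by blast
  then have "\<not> int p dvd x"
    using mod_residue[OF Q xy(2)] not_dvd_residue[of x] by auto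
  then obtain b where b: "b * x mod int p = 1"
    using inverse_mod_ex by blast
  define z where "z = b * y mod int p"
  have z: "(1, z) \<in> Q" "z \<in> {0..<int p}"
    using scale_mem[OF Q xy(2), of b] b p_gt_1 by (auto simp: z_def)
  show thesis
  proof (cases "Q \<subseteq> line p (1, z)")
    case True
    then show thesis
      using that(2) z line_subset[OF Q z(1)] by blast
  next
    case False
    then obtain s t where st: "(s, t) \<in> Q" "(s, t) \<notin> line p (1, z)"
      by (metis subsetI surj_pair)
    note st' = mod_residue[OF Q st(1)]
    have "(1, z) \<in> carrier (Zp2 p)"
      using z(2) p_gt_1 by simp
    then have "(s * 1 mod int p, s * z mod int p) \<in> line p (1, z)"
      using scale_mem subgroup_line mem_line by blast
    \<comment> \<open>Otherwise (s, t) would be the multiple \<open>s\<close> of (1, z) and lie on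
      its line.\<close>
    then have "(t - s * z) mod int p \<noteq> 0"
      using st st' by (metis mod_eq_dvd_iff mult.right_neutral dvd_eq_mod_eq_0)
    then have nd: "\<not> int p dvd (t - s * z)" by auto
    have "((- s) * 1 mod int p, (- s) * z mod int p) \<in> Q"
      by (rule scale_mem[OF Q z(1)])
    then have "((s + (- s)) mod int p, (t + (- s) * z) mod int p) \<in> Q"
      using st st' by (intro add_mem[OF Q]) simp_all
    \<comment> \<open>Subtracting \<open>s\<close> times (1, z) from (s, t) leaves a nonzero
      multiple of (0, 1).\<close>
    then have "((t - s * z) * 0 mod int p, (t - s * z) * 1 mod int p) \<in> Q"
      by simp
    then have e2: "(0, 1) \<in> Q"
      using scale_cancel[OF Q nd] p_gt_1 by fastforce
    have "(c, d) \<in> Q" if cd: "(c, d) \<in> carrier (Zp2 p)" for c d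
    proof -
      \<comment> \<open>The coordinates of (c, d) in the basis (1, z), (0, 1) are \<open>c\<close>
        and \<open>d - c * z\<close>.\<close>
      have "((c * 1 + (d - c * z) * 0) mod int p, (c * z + (d - c * z) * 1) mod int p) \<in> Q"
        using scale_mem[OF Q z(1), of c] scale_mem[OF Q e2, of "d - c * z"]
        by (intro add_mem[OF Q]) simp_all
      then show ?thesis
        using cd by simp
    qed
    then have "Q = carrier (Zp2 p)"
      using subgroup.subset[OF Q] by (auto simp del: carrier_Zp2)
    then show thesis by (rule that(4))
  qed
next
  case False
  show thesis
  proof (cases "Q = {(0, 0)}")
    case F2: False
    have "(0, 0) \<in> Q"
      using subgroup.one_closed[OF Q] by simp
    with F2 obtain v where v: "v \<in> Q" "v \<noteq> (0, 0)"
      by blast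
    obtain s y where sy: "v = (s, y)"
      by (cases v)
    have "s = 0"
      using False v(1)[unfolded sy] by blast
    with v sy have y: "(0, y) \<in> Q" "y \<noteq> 0"
      by simp_all
    then have nd: "\<not> int p dvd y"
      using mod_residue[OF Q y(1)] not_dvd_residue[of y] by auto
    have e2: "(0, 1) \<in> Q"
      using scale_cancel[OF Q nd, of 0 1] y mod_residue[OF Q y(1)] p_gt_1 by simp
    have e2c: "(0, 1) \<in> carrier (Zp2 p)" using p_gt_1 by simp
    have "(s, t) \<in> line p (0, 1)" if "(s, t) \<in> Q" for s t
    proof -
      have "(t * 0 mod int p, t * 1 mod int p) \<in> line p (0, 1)"
        using e2c scale_mem subgroup_line mem_line by blast
      moreover have "s = 0"
        using False that by blast
      ultimately show ?thesis
        using mod_residue[OF Q that] by simp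
    qed
    then have "Q = line p (0, 1)"
      using line_subset[OF Q e2] by auto
    then show thesis by (rule that(3))
  qed (use that in blast)
qed

section \<open>Subgroups of the form \<open>H \<ltimes> Q\<close>\<close>

lemma conjugate_AutZp2:
  assumes "(k, u, u') \<in> carrier (AutZp2 p)" "(h, x, y) \<in> carrier (AutZp2 p)"
  shows "(k, u, u') \<otimes>\<^bsub>AutZp2 p\<^esub> (h, x, y) \<otimes>\<^bsub>AutZp2 p\<^esub> inv\<^bsub>AutZp2 p\<^esub> (k, u, u') =
    (h, (k * x + (1 - h) * u) mod int p, (k * y + (1 - h) * u') mod int p)"
proof -
  let ?s = "(h, (k * x + (1 - h) * u) mod int p, (k * y + (1 - h) * u') mod int p)"
  have "?s \<in> carrier (AutZp2 p)"
    using assms p_gt_1 by (simp add: carrier_AutZp2)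
  \<comment> \<open>The equation \<open>g s = s' g\<close> identifies the conjugate without a
    formula for the inverse of \<open>g\<close>.\<close>
  moreover have "(k, u, u') \<otimes>\<^bsub>AutZp2 p\<^esub> (h, x, y) = ?s \<otimes>\<^bsub>AutZp2 p\<^esub> (k, u, u')"
    by (simp add: mod_simps algebra_simps)
  ultimately show ?thesis
    using assms by (intro A.inv_solve_right'[THEN iffD2] A.m_closed)
qed

lemma subgroup_Zp_star_residue: "subgroup H (Zp_star p) \<Longrightarrow> H \<subseteq> {1..<int p}"
  using subgroup.subset carrier_Zp_star by blast

lemma conjugate_times:
  assumes "subgroup H (Zp_star p)" "subgroup Q (Zp2 p)" "(k, u, u') \<in> carrier (AutZp2 p)"
  shows "(k, u, u') <#\<^bsub>AutZp2 p\<^esub> (H \<times> Q) #>\<^bsub>AutZp2 p\<^esub> inv\<^bsub>AutZp2 p\<^esub> (k, u, u') =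
    (\<lambda>(h, x, y). (h, (k * x + (1 - h) * u) mod int p, (k * y + (1 - h) * u') mod int p)) ` (H \<times> Q)"
proof -
  have sub: "H \<times> Q \<subseteq> carrier (AutZp2 p)"
    using subgroup_Zp_star_residue[OF assms(1)] subgroup.subset[OF assms(2)]
    by (auto simp: carrier_AutZp2)
  show ?thesis
    unfolding A.conjugate_set_eq_image[OF assms(3) sub]
  proof (rule image_cong[OF refl])
    fix s assume s: "s \<in> H \<times> Q"
    obtain h x y where hxy: "s = (h, x, y)"
      by (cases s)
    then have "(h, x, y) \<in> carrier (AutZp2 p)"
      using s sub by blast
    from conjugate_AutZp2[OF assms(3) this]
    show "(k, u, u') \<otimes>\<^bsub>AutZp2 p\<^esub> s \<otimes>\<^bsub>AutZp2 p\<^esub> inv\<^bsub>AutZp2 p\<^esub> (k, u, u') =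
      (case s of (h, x, y) \<Rightarrow> (h, (k * x + (1 - h) * u) mod int p, (k * y + (1 - h) * u') mod int p))"
      by (simp add: hxy)
  qed
qed

text \<open>Closure rests on linearity: multiplication by elements of \<open>H\<close> preserves
  \<open>Q\<close>, whatever \<open>H\<close> and \<open>Q\<close> are.\<close>

lemma subgroup_times:
  assumes H: "subgroup H (Zp_star p)" and Q: "subgroup Q (Zp2 p)"
  shows "subgroup (H \<times> Q) (AutZp2 p)"
proof (rule A.subgroupI)
  show sub: "H \<times> Q \<subseteq> carrier (AutZp2 p)"
    using subgroup_Zp_star_residue[OF H] subgroup.subset[OF Q]
    by (auto simp: carrier_AutZp2)
  show "H \<times> Q \<noteq> {}"
    using subgroup.one_closed[OF H] subgroup.one_closed[OF Q] by blast
  show "s \<otimes>\<^bsub>AutZp2 p\<^esub> t \<in> H \<times> Q" if st: "s \<in> H \<times> Q" "t \<in> H \<times> Q" for s t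
  proof -
    obtain h x y h' x' y' where eq: "s = (h, x, y)" "t = (h', x', y')"
      by (cases s, cases t)
    then have "(x, y) \<in> Q" "(x', y') \<in> Q" "h \<in> H" "h' \<in> H"
      using st by simp_all
    then have "h * h' mod int p \<in> H" "(h * x' mod int p, h * y' mod int p) \<in> Q"
      "(x mod int p, y mod int p) \<in> Q"
      using mod_residue[OF Q, of x y] scale_mem[OF Q, of x' y' h] subgroup.m_closed[OF H, of h h']
      by simp_all
    then show ?thesis
      using add_mem[OF Q] by (simp add: eq)
  qed
  show "inv\<^bsub>AutZp2 p\<^esub> s \<in> H \<times> Q" if s: "s \<in> H \<times> Q" for s
  proof -
    obtain h x y where eq: "s = (h, x, y)"
      by (cases s)
    then have s': "(x, y) \<in> Q" "h \<in> H" "s \<in> carrier (AutZp2 p)"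
      using s sub by blast+
    define k where "k = inv\<^bsub>Zp_star p\<^esub> h"
    have k: "k \<in> H" "k * h mod int p = 1"
      using s' subgroup.m_inv_closed[OF H] Zs.l_inv[of h] subgroup.mem_carrier[OF H]
      by (simp_all add: k_def)
    \<comment> \<open>The inverse of \<open>(h, v)\<close> is \<open>(k, - k v)\<close> with
      \<open>k\<close> the inverse of \<open>h\<close>.\<close>
    let ?t = "(k, - k * x mod int p, - k * y mod int p)"
    have t: "?t \<in> H \<times> Q"
      using k(1) scale_mem[OF Q s'(1), of "- k"] by simp
    moreover have "?t \<otimes>\<^bsub>AutZp2 p\<^esub> s = \<one>\<^bsub>AutZp2 p\<^esub>"
      using k(2) by (simp add: eq mod_simps)
    ultimately show ?thesis
      using A.inv_equality[of ?t s] s' sub by (metis subsetD)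
  qed
qed

text \<open>Conjugation fixes the dilation, and on translations it is multiplication by the unit
  \<open>k\<close>, which maps the subspace \<open>Q\<close> onto itself. So \<open>H\<close> and
  \<open>Q\<close> can be read off from any conjugate of their product.\<close>

lemma translation_part_eq:
  assumes H: "subgroup H (Zp_star p)" and Q: "subgroup Q (Zp2 p)"
    and g: "(k, u, u') \<in> carrier (AutZp2 p)"
    and K: "K = (k, u, u') <#\<^bsub>AutZp2 p\<^esub> (H \<times> Q) #>\<^bsub>AutZp2 p\<^esub> inv\<^bsub>AutZp2 p\<^esub> (k, u, u')"
  shows "fst ` K = H" "{v. (1, v) \<in> K} = Q"
proof -
  have K': "K = (\<lambda>(h, x, y). (h, (k * x + (1 - h) * u) mod int p, (k * y + (1 - h) * u') mod int p)) ` (H \<times> Q)"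
    unfolding K by (rule conjugate_times[OF H Q g])
  have Q0: "(0, 0) \<in> Q"
    using subgroup.one_closed[OF Q] by simp
  have H1: "1 \<in> H"
    using subgroup.one_closed[OF H] by simp
  have fst_eq: "fst (case s of (h, x, y) \<Rightarrow>
      (h, (k * x + (1 - h) * u) mod int p, (k * y + (1 - h) * u') mod int p)) = fst s" for s
    by (cases s) simp
  have "fst ` (H \<times> Q) = H"
    using Q0 by force
  then show "fst ` K = H"
    unfolding K' image_image fst_eq by simp
  have kd: "\<not> int p dvd k"
    using g not_dvd_residue by (simp add: carrier_AutZp2)
  have "(1, v) \<in> K \<longleftrightarrow> v \<in> Q" for v
  proof
    assume "(1, v) \<in> K"
    then obtain x y where "(x, y) \<in> Q" "v = (k * x mod int p, k * y mod int p)"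
      unfolding K' by auto
    then show "v \<in> Q"
      using scale_mem[OF Q] by blast
  next
    assume v: "v \<in> Q"
    obtain x y where xy: "v = (x, y)"
      by (cases v)
    obtain l where l: "l * k mod int p = 1"
      using inverse_mod_ex[OF kd] by blast
    have "k * (l * z) mod int p = z mod int p" for z
      using l by (metis mod_mult_left_eq mult.assoc mult.commute mult_1)
    \<comment> \<open>The preimage of \<open>v\<close> under multiplication by \<open>k\<close> is
      \<open>l v\<close>, again in \<open>Q\<close>.\<close>
    then have "v = (k * (l * x mod int p) mod int p, k * (l * y mod int p) mod int p)"
      using mod_residue[OF Q v[unfolded xy]] xy by (simp add: mod_simps)
    moreover have "(1, l * x mod int p, l * y mod int p) \<in> H \<times> Q"
      using H1 scale_mem[OF Q v[unfolded xy]] by simp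
    ultimately show "(1, v) \<in> K"
      unfolding K' by (intro image_eqI[of _ _ "(1, l * x mod int p, l * y mod int p)"]) simp_all
  qed
  then show "{v. (1, v) \<in> K} = Q" by simp
qed

lemma conjugate_times_unique:
  assumes "subgroup H (Zp_star p)" "subgroup Q (Zp2 p)" "conjugate_in (AutZp2 p) K (H \<times> Q)"
    and "subgroup H' (Zp_star p)" "subgroup Q' (Zp2 p)" "conjugate_in (AutZp2 p) K (H' \<times> Q')"
  shows "H = H'" "Q = Q'"
  using assms unfolding conjugate_in_def by (metis prod_cases3 translation_part_eq)+

section \<open>Normalizers of products\<close>

lemma normalizer_eq:
  assumes "S \<subseteq> carrier (AutZp2 p)"
  shows "normalizer (AutZp2 p) S =
    {g \<in> carrier (AutZp2 p). g <#\<^bsub>AutZp2 p\<^esub> S #>\<^bsub>AutZp2 p\<^esub> inv\<^bsub>AutZp2 p\<^esub> g = S}"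
  using assms by (auto simp: normalizer_def stabilizer_def)

text \<open>If \<open>H\<close> is trivial, the factor \<open>1 - h\<close> vanishes and conjugation
  only rescales \<open>Q\<close>. Otherwise some \<open>1 - h\<close> is invertible, and
  \<open>(1 - h) u\<close> lies in \<open>Q\<close> exactly when \<open>u\<close> does.\<close>

lemma normalizer_times:
  assumes H: "subgroup H (Zp_star p)" and Q: "subgroup Q (Zp2 p)"
  shows "normalizer (AutZp2 p) (H \<times> Q) =
    (if H = {1} then carrier (AutZp2 p) else carrier (Zp_star p) \<times> Q)"
proof -
  have sub: "H \<times> Q \<subseteq> carrier (AutZp2 p)"
    using subgroup.subset[OF subgroup_times[OF H Q]] .
  have "finite (carrier (AutZp2 p))"
    by (simp add: carrier_AutZp2)
  then have fin: "finite (H \<times> Q)"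
    using sub finite_subset by blast
  have Q0: "(0, 0) \<in> Q"
    using subgroup.one_closed[OF Q] by simp
  have "g <#\<^bsub>AutZp2 p\<^esub> (H \<times> Q) #>\<^bsub>AutZp2 p\<^esub> inv\<^bsub>AutZp2 p\<^esub> g = H \<times> Q \<longleftrightarrow>
      H = {1} \<or> snd g \<in> Q" if g: "g \<in> carrier (AutZp2 p)" for g
  proof -
    obtain k u u' where kuu: "g = (k, u, u')"
      by (cases g)
    define c where "c = (\<lambda>(h, x, y).
      (h, (k * x + (1 - h) * u) mod int p, (k * y + (1 - h) * u') mod int p))"
    have img: "g <#\<^bsub>AutZp2 p\<^esub> (H \<times> Q) #>\<^bsub>AutZp2 p\<^esub> inv\<^bsub>AutZp2 p\<^esub> g = c ` (H \<times> Q)"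
      using conjugate_times[OF H Q] g by (simp add: kuu c_def)
    \<comment> \<open>Conjugation is injective and the set is finite, so being mapped into itself
      already means being mapped onto itself.\<close>
    have "inj_on (\<lambda>s. g \<otimes>\<^bsub>AutZp2 p\<^esub> s \<otimes>\<^bsub>AutZp2 p\<^esub> inv\<^bsub>AutZp2 p\<^esub> g) (H \<times> Q)"
      using g sub by (intro inj_onI) (meson A.conjugation_is_inj subsetD)
    then have "card (c ` (H \<times> Q)) = card (H \<times> Q)"
      using img A.conjugate_set_eq_image[OF g sub] card_image by metis
    then have "c ` (H \<times> Q) = H \<times> Q \<longleftrightarrow> c ` (H \<times> Q) \<subseteq> H \<times> Q"
      using card_subset_eq[OF fin] by auto
    also have "\<dots> \<longleftrightarrow> H = {1} \<or> (u, u') \<in> Q"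
    proof
      assume c: "c ` (H \<times> Q) \<subseteq> H \<times> Q"
      show "H = {1} \<or> (u, u') \<in> Q"
      proof (cases "H = {1}")
        case False
        have "1 \<in> H"
          using subgroup.one_closed[OF H] by simp
        with False obtain h where h: "h \<in> H" "h \<noteq> 1"
          by blast
        \<comment> \<open>On a pure dilation the conjugate has translation part exactly
          \<open>(1 - h) u\<close>.\<close>
        have "c (h, 0, 0) \<in> H \<times> Q"
          using c h(1) Q0 by blast
        then have "((1 - h) * u mod int p, (1 - h) * u' mod int p) \<in> Q"
          by (simp add: c_def)
        moreover have "\<not> int p dvd (1 - h)"
          using h subgroup_Zp_star_residue[OF H] zdvd_not_zless[of "h - 1" "int p"]
          by (subst dvd_diff_commute) force
        ultimately have "(u mod int p, u' mod int p) \<in> Q"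
          using scale_cancel[OF Q] by blast
        then show ?thesis
          using g by (simp add: kuu carrier_AutZp2)
      qed simp
    next
      assume hu: "H = {1} \<or> (u, u') \<in> Q"
      show "c ` (H \<times> Q) \<subseteq> H \<times> Q"
      proof (rule image_subsetI)
        fix s assume s: "s \<in> H \<times> Q"
        obtain h x y where eq: "s = (h, x, y)"
          by (cases s)
        then have h: "h \<in> H" "(x, y) \<in> Q"
          using s by simp_all
        have "((1 - h) * u mod int p, (1 - h) * u' mod int p) \<in> Q"
          using hu
        proof
          assume "H = {1}"
          then show ?thesis
            using h(1) Q0 by simp
        qed (rule scale_mem[OF Q])
        then have "((k * x + (1 - h) * u) mod int p, (k * y + (1 - h) * u') mod int p) \<in> Q"
          using scale_mem[OF Q h(2), of k] by (intro add_mem[OF Q]) simp_all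
        then show "c s \<in> H \<times> Q"
          using h(1) by (simp add: c_def eq)
      qed
    qed
    finally show ?thesis
      unfolding img by (simp add: kuu)
  qed
  then have "normalizer (AutZp2 p) (H \<times> Q) =
      {g \<in> carrier (AutZp2 p). H = {1} \<or> snd g \<in> Q}"
    unfolding normalizer_eq[OF sub] by blast
  moreover have "{g \<in> carrier (AutZp2 p). snd g \<in> Q} = carrier (Zp_star p) \<times> Q"
    using subgroup.subset[OF Q] by (auto simp: carrier_AutZp2 carrier_Zp_star)
  ultimately show ?thesis
    by auto
qed

section \<open>Every subgroup is conjugate to a product\<close>

lemma conjugate_to_times:
  assumes K: "subgroup K (AutZp2 p)"
  obtains H Q where "subgroup H (Zp_star p)" "subgroup Q (Zp2 p)"
    "conjugate_in (AutZp2 p) K (H \<times> Q)"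
proof -
  define H where "H = fst ` K"
  define Q where "Q = {v. (1, v) \<in> K}"
  have K_sub: "K \<subseteq> carrier (AutZp2 p)"
    by (rule subgroup.subset[OF K])
  have K1: "(1, 0, 0) \<in> K"
    using subgroup.one_closed[OF K] by simp
  interpret fst_hom: group_hom "AutZp2 p" "Zp_star p" fst
    by unfold_locales (auto simp: hom_def carrier_AutZp2 carrier_Zp_star AutZp2_def)
  have H: "subgroup H (Zp_star p)"
    unfolding H_def by (rule fst_hom.subgroup_img_is_subgroup[OF K])
  have Q: "subgroup Q (Zp2 p)"
  proof (rule Z2.subgroupI)
    show sub: "Q \<subseteq> carrier (Zp2 p)"
      using K_sub by (auto simp: Q_def carrier_AutZp2)
    show "Q \<noteq> {}"
      using K1 by (auto simp: Q_def)
    show "v \<otimes>\<^bsub>Zp2 p\<^esub> w \<in> Q" if vw: "v \<in> Q" "w \<in> Q" for v w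
    proof -
      obtain x y x' y' where eq: "v = (x, y)" "w = (x', y')"
        by (cases v, cases w)
      show ?thesis
        using subgroup.m_closed[OF K, of "(1, v)" "(1, w)"] vw p_gt_1
        by (simp add: Q_def eq add.commute)
    qed
    show "inv\<^bsub>Zp2 p\<^esub> v \<in> Q" if v: "v \<in> Q" for v
    proof -
      obtain x y where eq: "v = (x, y)"
        by (cases v)
      have c: "(x, y) \<in> carrier (Zp2 p)"
        using v sub eq by blast
      have "inv\<^bsub>AutZp2 p\<^esub> (1, v) = (1, inv\<^bsub>Zp2 p\<^esub> v)"
        using c p_gt_1 unfolding eq inv_Zp2[OF c]
        by (intro A.inv_equality) (auto simp: carrier_AutZp2 mod_simps)
      then show ?thesis
        using subgroup.m_inv_closed[OF K, of "(1, v)"] v by (simp add: Q_def)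
    qed
  qed
  \<comment> \<open>Elements of \<open>K\<close> with equal dilation differ by a translation of
    \<open>K\<close>: \<open>Q\<close> is the kernel of the projection to \<open>H\<close>.\<close>
  have quot: "((x - x') mod int p, (y - y') mod int p) \<in> Q"
    if "(h, x, y) \<in> K" "(h, x', y') \<in> K" for h x y x' y'
  proof -
    have c: "(h, x, y) \<in> carrier (AutZp2 p)" "(h, x', y') \<in> carrier (AutZp2 p)"
      using that K_sub by blast+
    have "(1, (x - x') mod int p, (y - y') mod int p) \<otimes>\<^bsub>AutZp2 p\<^esub> (h, x', y') = (h, x, y)"
      using c by (simp add: carrier_AutZp2 mod_simps)
    then have "(h, x, y) \<otimes>\<^bsub>AutZp2 p\<^esub> inv\<^bsub>AutZp2 p\<^esub> (h, x', y') =
        (1, (x - x') mod int p, (y - y') mod int p)"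
      using c p_gt_1 by (subst A.inv_solve_right') (simp_all add: carrier_AutZp2)
    then show ?thesis
      using subgroup.m_closed[OF K that(1) subgroup.m_inv_closed[OF K that(2)]]
      by (simp add: Q_def)
  qed
  have Q_add: "(h, (x + q) mod int p, (y + r) mod int p) \<in> K"
    if "(h, x, y) \<in> K" "(q mod int p, r mod int p) \<in> Q" for h x y q r
  proof -
    have "h mod int p = h"
      using that K_sub carrier_AutZp2 by auto
    then show ?thesis
      using subgroup.m_closed[OF K, of "(1, q mod int p, r mod int p)" "(h, x, y)"] that
      by (simp add: Q_def mod_simps)
  qed
  \<comment> \<open>The point sought makes the translation part of every element with dilation
    \<open>h\<close> equal to \<open>(1 - h) u\<close> modulo \<open>Q\<close>. When
    \<open>H\<close> is trivial, \<open>u = 0\<close> serves.\<close>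
  have "\<exists>u u'. u \<in> {0..<int p} \<and> u' \<in> {0..<int p} \<and>
      (\<forall>(h, x, y) \<in> K. ((x - (1 - h) * u) mod int p, (y - (1 - h) * u') mod int p) \<in> Q)"
  proof (cases "H = {1}")
    case True
    have "((x - (1 - h) * 0) mod int p, (y - (1 - h) * 0) mod int p) \<in> Q" if "(h, x, y) \<in> K" for h x y
    proof -
      have "h = 1"
        using that True by (force simp: H_def)
      then show ?thesis
        using quot[OF that, of 0 0] K1 by simp
    qed
    then show ?thesis
      using p_gt_1 by (intro exI[of _ 0]) auto
  next
    case False
    have "1 \<in> H"
      using subgroup.one_closed[OF H] by simp
    with False obtain k where k: "k \<in> H" "k \<noteq> 1"
      by blast
    then obtain s where s: "s \<in> K" "fst s = k"
      unfolding H_def by blast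
    obtain a b where ab: "s = (k, a, b)"
      using s(2) by (cases s) simp
    have kd: "\<not> int p dvd (1 - k)"
      using k subgroup_Zp_star_residue[OF H] zdvd_not_zless[of "k - 1" "int p"]
      by (subst dvd_diff_commute) force
    obtain l where l: "l * (1 - k) mod int p = 1"
      using inverse_mod_ex[OF kd] by blast
    have kd': "\<not> int p dvd (k - 1)"
      using kd by (subst dvd_diff_commute)
    \<comment> \<open>Division by \<open>1 - k\<close>: the point (\<open>f a\<close>,
      \<open>f b\<close>) is the fixed point of the affine map with dilation \<open>k\<close> and
      translation part (a, b).\<close>
    define f where "f a = l * a mod int p" for a
    have f: "[(1 - k) * f a = a] (mod int p)" for a
    proof -
      have "[l * (1 - k) = 1] (mod int p)"
        using l p_gt_1 by (simp add: cong_def)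
      then have "[l * (1 - k) * a = 1 * a] (mod int p)"
        by (rule cong_scalar_right)
      then show ?thesis
        by (simp add: f_def cong_def mod_simps mult.commute mult.left_commute)
    qed
    have "((x - (1 - h) * f a) mod int p, (y - (1 - h) * f b) mod int p) \<in> Q"
      if hxy: "(h, x, y) \<in> K" for h x y
    proof -
      \<comment> \<open>The products in both orders have the same dilation, so \<open>quot\<close>
        puts the difference of their translation parts, the commutator up to a factor, into
        \<open>Q\<close>.\<close>
      have "(k * h mod int p, (k * x + a) mod int p, (k * y + b) mod int p) \<in> K"
        using subgroup.m_closed[OF K s(1) hxy] by (simp add: ab)
      moreover have "(k * h mod int p, (h * a + x) mod int p, (h * b + y) mod int p) \<in> K"
        using subgroup.m_closed[OF K hxy s(1)] by (simp add: ab mult.commute)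
      ultimately have
        "(((k * x + a) mod int p - (h * a + x) mod int p) mod int p,
          ((k * y + b) mod int p - (h * b + y) mod int p) mod int p) \<in> Q"
        by (rule quot)
      \<comment> \<open>Replacing \<open>a\<close> by \<open>(1 - k) * f a\<close> lets the factor
        \<open>k - 1\<close> come out, and \<open>scale_cancel\<close> then removes it.\<close>
      moreover have "((k * x + a) mod int p - (h * a + x) mod int p) mod int p =
          (k - 1) * (x - (1 - h) * f a) mod int p" for x a
      proof -
        have "[(k * x + a) - (h * a + x) = (k - 1) * x + (1 - h) * a] (mod int p)"
          by (simp add: algebra_simps)
        also have "[(k - 1) * x + (1 - h) * a = (k - 1) * x + (1 - h) * ((1 - k) * f a)] (mod int p)"
          using f[of a] by (intro cong_add cong_mult cong_refl) (rule cong_sym)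
        also have "(k - 1) * x + (1 - h) * ((1 - k) * f a) = (k - 1) * (x - (1 - h) * f a)"
          by (simp add: algebra_simps)
        finally show ?thesis
          by (simp add: cong_def mod_simps)
      qed
      ultimately have "((k - 1) * (x - (1 - h) * f a) mod int p,
          (k - 1) * (y - (1 - h) * f b) mod int p) \<in> Q"
        by simp
      then show ?thesis
        by (rule scale_cancel[OF Q kd'])
    qed
    then show ?thesis
      using p_gt_1 by (intro exI[of _ "f a"] exI[of _ "f b"]) (auto simp: f_def)
  qed
  then obtain u u' where u: "u \<in> {0..<int p}" "u' \<in> {0..<int p}"
    and uQ: "\<And>h x y. (h, x, y) \<in> K \<Longrightarrow>
      ((x - (1 - h) * u) mod int p, (y - (1 - h) * u') mod int p) \<in> Q"
    by blast
  have g: "(1, u, u') \<in> carrier (AutZp2 p)"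
    using u p_gt_1 by (simp add: carrier_AutZp2)
  define c where "c = (\<lambda>(h, x, y).
      (h, (1 * x + (1 - h) * u) mod int p, (1 * y + (1 - h) * u') mod int p))"
  have "K = c ` (H \<times> Q)"
  proof (intro equalityI subsetI)
    fix s assume s: "s \<in> K"
    obtain h x y where eq: "s = (h, x, y)"
      by (cases s)
    have "(h, x, y) \<in> carrier (AutZp2 p)"
      using s K_sub eq by blast
    then have "s = c (h, (x - (1 - h) * u) mod int p, (y - (1 - h) * u') mod int p)"
      by (simp add: c_def eq carrier_AutZp2 mod_simps)
    moreover have "h \<in> H"
      using s eq by (force simp: H_def)
    moreover have "((x - (1 - h) * u) mod int p, (y - (1 - h) * u') mod int p) \<in> Q"
      using uQ s eq by simp
    ultimately show "s \<in> c ` (H \<times> Q)"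
      by (rule image_eqI[OF _ SigmaI])
  next
    fix s assume "s \<in> c ` (H \<times> Q)"
    then obtain h q r where hqr: "h \<in> H" "(q, r) \<in> Q" "s = c (h, q, r)"
      by auto
    then obtain t where t: "t \<in> K" "fst t = h"
      unfolding H_def by blast
    obtain x y where eq: "t = (h, x, y)"
      using t(2) by (cases t) simp
    have xy: "(h, x, y) \<in> K"
      using t(1) eq by simp
    \<comment> \<open>This is the element of \<open>Q\<close> by which the translation part of
      \<open>s\<close> differs from that of an element of \<open>K\<close> with the same
      dilation.\<close>
    have "((q + (-1) * (x - (1 - h) * u)) mod int p, (r + (-1) * (y - (1 - h) * u')) mod int p) \<in> Q"
      using hqr(2) mod_residue[OF Q hqr(2)] scale_mem[OF Q uQ[OF xy], of "-1"]
      by (intro add_mem[OF Q]) (simp_all add: mod_simps)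
    from Q_add[OF xy this] show "s \<in> K"
      by (simp add: hqr(3) c_def algebra_simps)
  qed
  then have "conjugate_in (AutZp2 p) K (H \<times> Q)"
    unfolding conjugate_in_def using conjugate_times[OF H Q g] g
    by (intro bexI[of _ "(1, u, u')"]) (simp_all add: c_def)
  then show thesis
    using that H Q by blast
qed

section \<open>Representatives\<close>

lemma subgroup_H_sub:
  assumes "m0 \<in> carrier (Zp_star p)"
  shows "subgroup (H_sub p m0 d) (Zp_star p)"
  unfolding H_sub_def using assms by (intro Zs.generate_is_subgroup) simp

lemma line_in_Zp2:
  assumes "y \<in> carrier (Zp p)"
  shows "(1, y) \<in> carrier (Zp2 p)" "(0, 1) \<in> carrier (Zp2 p)"
  using assms p_gt_1 by auto

section \<open>Telling the subspaces apart\<close>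

lemma mem_line_1_iff:
  assumes "y \<in> carrier (Zp p)" "z \<in> carrier (Zp p)"
  shows "(1, z) \<in> line p (1, y) \<longleftrightarrow> z = y"
proof
  assume "(1, z) \<in> line p (1, y)"
  then obtain a where "1 = a mod int p" "z = a * y mod int p"
    unfolding line_eq[OF line_in_Zp2(1)[OF assms(1)]] by auto
  then have "z = 1 * y mod int p"
    by (metis mod_mult_left_eq)
  then show "z = y"
    using assms by simp
qed (use mem_line in simp)

lemma line_1_fst_zero:
  assumes "y \<in> carrier (Zp p)" "(0, z) \<in> line p (1, y)"
  shows "z = 0"
proof -
  obtain a where "0 = a mod int p" "z = a * y mod int p"
    using assms(2) unfolding line_eq[OF line_in_Zp2(1)[OF assms(1)]] by auto
  then show ?thesis
    by (metis mod_mult_left_eq mod_0 mult_zero_left)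
qed

lemma line_0_fst:
  assumes "(x, z) \<in> line p (0, 1)"
  shows "x = 0"
proof -
  have "(0, 1) \<in> carrier (Zp2 p)"
    using p_gt_1 by simp
  then show ?thesis
    using assms by (auto simp: line_eq)
qed

lemma line_distinct:
  assumes y: "y \<in> carrier (Zp p)"
  shows "line p (1, y) \<noteq> {(0, 0)}" "line p (1, y) \<noteq> line p (0, 1)"
    "line p (1, y) \<noteq> carrier (Zp2 p)"
proof -
  have 1: "(1, y) \<in> line p (1, y)"
    by (rule mem_line)
  then show "line p (1, y) \<noteq> {(0, 0)}" by auto
  from 1 line_0_fst[of 1 y] show "line p (1, y) \<noteq> line p (0, 1)" by auto
  have "(0, 1) \<in> carrier (Zp2 p)" "(0, 1) \<notin> line p (1, y)"
    using line_1_fst_zero[OF y, of 1] p_gt_1 by auto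
  then show "line p (1, y) \<noteq> carrier (Zp2 p)" by blast
qed

lemma line_0_distinct:
  "line p (0, 1) \<noteq> {(0, 0)}" "line p (0, 1) \<noteq> carrier (Zp2 p)"
  "{(0, 0)} \<noteq> carrier (Zp2 p)"
proof -
  have "(0, 1) \<in> line p (0, 1)"
    by (rule mem_line)
  then show "line p (0, 1) \<noteq> {(0, 0)}" by auto
  have 1: "(1, 0) \<in> carrier (Zp2 p)"
    using p_gt_1 by simp
  moreover have "(1, 0) \<notin> line p (0, 1)"
    using line_0_fst[of 1 0] by auto
  ultimately show "line p (0, 1) \<noteq> carrier (Zp2 p)" by blast
  have "(1, 0) \<notin> {(0::int, 0::int)}" by simp
  with 1 show "{(0, 0)} \<noteq> carrier (Zp2 p)" by blast
qed

lemma line_eq_iff: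
  assumes "y \<in> carrier (Zp p)" "z \<in> carrier (Zp p)"
  shows "line p (1, y) = line p (1, z) \<longleftrightarrow> y = z"
  using assms mem_line_1_iff mem_line by metis

context
  fixes m0 :: int
  assumes m0: "m0 \<in> carrier (Zp_star p)" "generate (Zp_star p) {m0} = carrier (Zp_star p)"
begin

section \<open>The subgroups of the unit group\<close>

lemma card_H_sub: "d dvd p - 1 \<Longrightarrow> card (H_sub p m0 d) = (p - 1) div d"
  unfolding H_sub_def
  using Zs.card_generate_generator_pow[OF finite_Zp_star m0] by (simp add: order_Zp_star)

text \<open>The order \<open>(p - 1) div d\<close> determines the divisor \<open>d\<close>.\<close>

lemma H_sub_eq_iff:
  assumes "d dvd p - 1" "e dvd p - 1"
  shows "H_sub p m0 d = H_sub p m0 e \<longleftrightarrow> d = e"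
proof
  assume "H_sub p m0 d = H_sub p m0 e"
  then have "(p - 1) div d = (p - 1) div e"
    using card_H_sub assms by metis
  then have "d * ((p - 1) div d) = e * ((p - 1) div d)"
    using assms by (metis dvd_mult_div_cancel)
  moreover have "p - 1 > 0"
    using p_gt_1 by simp
  then have "(p - 1) div d > 0"
    using dvd_div_mult_self[OF assms(1)] by (metis mult_0 not_gr_zero)
  ultimately show "d = e"
    by simp
qed simp

lemma H_sub_top: "H_sub p m0 (p - 1) = {1}"
proof -
  have "m0 [^]\<^bsub>Zp_star p\<^esub> (p - 1) = \<one>\<^bsub>Zp_star p\<^esub>"
    using Zs.pow_order_eq_1[OF m0(1)] by (simp only: order_Zp_star)
  then show ?thesis
    unfolding H_sub_def using Zs.generate_one by simp
qed

lemma H_sub_eq_1_iff: "d dvd p - 1 \<Longrightarrow> H_sub p m0 d = {1} \<longleftrightarrow> d = p - 1"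
  using H_sub_eq_iff[of d "p - 1"] unfolding H_sub_top by simp

lemma subgroup_Zp_star_eq_H_sub:
  assumes "subgroup H (Zp_star p)"
  obtains d where "d dvd p - 1" "H = H_sub p m0 d"
  using Zs.subgroup_eq_generate_pow[OF finite_Zp_star m0 assms] unfolding order_Zp_star H_sub_def
  by blast

text \<open>A proper divisor \<open>d\<close> of the order of the generator gives a power different
  from 1, so the difference from 1 is nonzero and invertible in the field.\<close>

lemma normalizer_scalar_unit:
  assumes "d dvd p - 1" "d \<noteq> p - 1"
  shows "normalizer_scalar p m0 d \<in> {1..<int p}"
proof -
  let ?R = "residue_ring (int p)"
  have pow: "m0 [^]\<^bsub>?R\<^esub> d = m0 [^]\<^bsub>Zp_star p\<^esub> d"
    by (simp add: Zp_star_def nat_pow_def units_of_def)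
  have "p - 1 > 0"
    using p_gt_1 by simp
  then have "d < p - 1" "d > 0"
    using assms dvd_imp_le[of d "p - 1"] dvd_pos_nat[of "p - 1" d] by linarith+
  then have "\<not> p - 1 dvd d"
    by (simp add: nat_dvd_not_less)
  then have "m0 [^]\<^bsub>Zp_star p\<^esub> d \<noteq> 1"
    using Zs.pow_eq_id[OF m0(1), of d] Zs.ord_generator[OF m0] by (simp add: order_Zp_star)
  moreover have "m0 [^]\<^bsub>Zp_star p\<^esub> d \<in> carrier (Zp_star p)"
    using m0(1) by simp
  ultimately have ne: "m0 [^]\<^bsub>?R\<^esub> d \<in> carrier ?R" "m0 [^]\<^bsub>?R\<^esub> d \<noteq> \<one>\<^bsub>?R\<^esub>"
    by (auto simp: pow carrier_Zp_star res_carrier_eq res_one_eq)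
  then have "\<one>\<^bsub>?R\<^esub> \<ominus>\<^bsub>?R\<^esub> m0 [^]\<^bsub>?R\<^esub> d \<noteq> \<zero>\<^bsub>?R\<^esub>"
    by (metis one_closed r_right_minus_eq)
  then have "\<one>\<^bsub>?R\<^esub> \<ominus>\<^bsub>?R\<^esub> m0 [^]\<^bsub>?R\<^esub> d \<in> Units ?R"
    using ne by (simp add: field_Units)
  then have "normalizer_scalar p m0 d \<in> Units ?R"
    unfolding normalizer_scalar_def Let_def by (rule Units_inv_Units)
  then show ?thesis
    using carrier_Zp_star by (simp add: Zp_star_def units_of_carrier)
qed

section \<open>Representatives as pairs of a dilation group and a subspace\<close>

fun rep_dilations :: "rep \<Rightarrow> int set" where
  "rep_dilations (Rep_H d) = H_sub p m0 d"
| "rep_dilations (Rep_H_line d y) = H_sub p m0 d"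
| "rep_dilations (Rep_H_vertical d) = H_sub p m0 d"
| "rep_dilations (Rep_H_plane d) = H_sub p m0 d"
| "rep_dilations _ = {1}"

fun rep_translations :: "rep \<Rightarrow> (int \<times> int) set" where
  "rep_translations Rep_trivial = {(0, 0)}"
| "rep_translations (Rep_H d) = {(0, 0)}"
| "rep_translations (Rep_line y) = line p (1, y)"
| "rep_translations (Rep_H_line d y) = line p (1, y)"
| "rep_translations Rep_vertical = line p (0, 1)"
| "rep_translations (Rep_H_vertical d) = line p (0, 1)"
| "rep_translations (Rep_H_plane d) = carrier (Zp2 p)"

lemma rep_subgroup_eq_times: "rep_subgroup p m0 i = rep_dilations i \<times> rep_translations i"
  by (cases i) simp_all

lemma subgroup_rep_dilations: "subgroup (rep_dilations i) (Zp_star p)"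
  using subgroup_H_sub[OF m0(1)] Zs.triv_subgroup by (cases i) simp_all

lemma subgroup_rep_translations: "valid_rep p i \<Longrightarrow> subgroup (rep_translations i) (Zp2 p)"
  using subgroup_line p_gt_1 Z2.triv_subgroup Z2.subgroup_self by (cases i) auto

lemma subgroup_rep: "valid_rep p i \<Longrightarrow> subgroup (rep_subgroup p m0 i) (AutZp2 p)"
  unfolding rep_subgroup_eq_times
  by (intro subgroup_times subgroup_rep_dilations subgroup_rep_translations)

text \<open>The restriction \<open>d \<noteq> p - 1\<close> separates the families with
  \<open>H_sub\<close> from those with trivial dilations; subspaces separate the rest. Only the
  plane family admits \<open>d = p - 1\<close>, since no other entry has the full plane.\<close>

lemma rep_eqI:
  assumes "valid_rep p i" "valid_rep p j"
    "rep_dilations i = rep_dilations j" "rep_translations i = rep_translations j"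
  shows "i = j"
  using assms
  by (cases i; cases j)
    (simp_all del: carrier_Zp2 carrier_Zp One_nat_def add: H_sub_eq_iff H_sub_eq_1_iff
      H_sub_eq_1_iff[THEN trans[OF eq_commute]] line_eq_iff line_distinct line_distinct[symmetric]
      line_0_distinct line_0_distinct[symmetric])

text \<open>For the three smaller kinds of subspace the choice of entry depends on whether
  \<open>H\<close> is trivial, that is \<open>d = p - 1\<close>; for the plane a single family
  covers all \<open>d\<close>.\<close>

lemma ex_rep:
  assumes H: "subgroup H (Zp_star p)" and Q: "subgroup Q (Zp2 p)"
  obtains i where "valid_rep p i" "rep_dilations i = H" "rep_translations i = Q"
proof -
  obtain d where d: "d dvd p - 1" "H = H_sub p m0 d"
    using subgroup_Zp_star_eq_H_sub[OF H] by blast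
  show thesis
    using Q
  proof (cases rule: subgroup_Zp2_cases)
    case 1
    with d show ?thesis
      using that[of Rep_trivial] that[of "Rep_H d"]
      by (cases "d = p - 1") (simp_all del: One_nat_def add: H_sub_top)
  next
    case (2 y)
    with d show ?thesis
      using that[of "Rep_line y"] that[of "Rep_H_line d y"]
      by (cases "d = p - 1") (simp_all del: One_nat_def add: H_sub_top)
  next
    case 3
    with d show ?thesis
      using that[of Rep_vertical] that[of "Rep_H_vertical d"]
      by (cases "d = p - 1") (simp_all del: One_nat_def add: H_sub_top)
  next
    case 4
    with d show ?thesis
      using that[of "Rep_H_plane d"] by simp
  qed
qed

text \<open>The normalizers come from \<open>normalizer_times\<close> once \<open>line_scale\<close>
  has absorbed the scalar. For the plane both branches of the conditional give the whole
  group.\<close>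

lemma normalizer_rep:
  assumes "valid_rep p i"
  shows "normalizer (AutZp2 p) (rep_subgroup p m0 i) = rep_normalizer p m0 i"
proof -
  have "normalizer (AutZp2 p) (rep_subgroup p m0 i) =
      (if rep_dilations i = {1} then carrier (AutZp2 p)
       else carrier (Zp_star p) \<times> rep_translations i)"
    unfolding rep_subgroup_eq_times
    using assms by (intro normalizer_times subgroup_rep_dilations subgroup_rep_translations)
  moreover have "carrier (AutZp2 p) = carrier (Zp_star p) \<times> carrier (Zp2 p)"
    by (simp add: AutZp2_def)
  moreover have "line p (scale p (normalizer_scalar p m0 d) v) = line p v"
    if "d dvd p - 1" "d \<noteq> p - 1" "v \<in> carrier (Zp2 p)" for d v
    using that line_scale normalizer_scalar_unit by (cases v) blast
  ultimately show ?thesis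
    using assms p_gt_1
    by (cases i) (simp_all del: scale_pair One_nat_def add: H_sub_eq_1_iff)
qed

text \<open>Existence combines \<open>conjugate_to_times\<close> with \<open>ex_rep\<close>. For
  uniqueness, \<open>K\<close> determines the dilation group and the subspace, and these determine
  the entry.\<close>

lemma ex1_rep:
  assumes "subgroup K (AutZp2 p)"
  shows "\<exists>!i. valid_rep p i \<and> conjugate_in (AutZp2 p) K (rep_subgroup p m0 i)"
proof (rule ex_ex1I)
  show "\<exists>i. valid_rep p i \<and> conjugate_in (AutZp2 p) K (rep_subgroup p m0 i)"
    using conjugate_to_times[OF assms] ex_rep by (metis rep_subgroup_eq_times)
next
  fix i j
  assume i: "valid_rep p i \<and> conjugate_in (AutZp2 p) K (rep_subgroup p m0 i)"
    and j: "valid_rep p j \<and> conjugate_in (AutZp2 p) K (rep_subgroup p m0 j)"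
  have "subgroup (rep_translations i) (Zp2 p)" "subgroup (rep_translations j) (Zp2 p)"
    using i j subgroup_rep_translations by simp_all
  then have "rep_dilations i = rep_dilations j" "rep_translations i = rep_translations j"
    using conjugate_times_unique[of "rep_dilations i" "rep_translations i" K
        "rep_dilations j" "rep_translations j"] i j subgroup_rep_dilations
    unfolding rep_subgroup_eq_times by blast+
  with i j show "i = j"
    using rep_eqI by blast
qed

end

end

theorem mainTheorem5:
  fixes p :: nat
  assumes "prime p"
  shows
    "mult_map p \<in> iso (Zp_star p) (AutoGroup (Zp p)) \<and>
     to_autotopism p \<in> iso (AutZp2 p) (Atp (Zp p)) \<and>
     (\<forall>K. subgroup K (AutZp2 p) \<longrightarrow>
        (\<exists>H Q. subgroup H (Zp_star p) \<and> subgroup Q (Zp2 p) \<and>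
           conjugate_in (AutZp2 p) K (H \<times> Q))) \<and>
     cyclic_group (Zp_star p) \<and>
     (\<forall>m0\<in>carrier (Zp_star p). generate (Zp_star p) {m0} = carrier (Zp_star p) \<longrightarrow>
        (\<forall>d. d dvd p - 1 \<longrightarrow>
           subgroup (H_sub p m0 d) (Zp_star p) \<and> card (H_sub p m0 d) = (p - 1) div d) \<and>
        (\<forall>i. valid_rep p i \<longrightarrow>
           subgroup (rep_subgroup p m0 i) (AutZp2 p) \<and>
           normalizer (AutZp2 p) (rep_subgroup p m0 i) = rep_normalizer p m0 i) \<and>
        (\<forall>K. subgroup K (AutZp2 p) \<longrightarrow>
           (\<exists>!i. valid_rep p i \<and> conjugate_in (AutZp2 p) K (rep_subgroup p m0 i))))"
proof (intro conjI ballI allI impI)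
  show "mult_map p \<in> iso (Zp_star p) (AutoGroup (Zp p))"
    by (rule mult_map_iso[OF assms])
  show "to_autotopism p \<in> iso (AutZp2 p) (Atp (Zp p))"
    by (rule to_autotopism_iso[OF assms])
  show "\<exists>H Q. subgroup H (Zp_star p) \<and> subgroup Q (Zp2 p) \<and> conjugate_in (AutZp2 p) K (H \<times> Q)"
    if "subgroup K (AutZp2 p)" for K
    using conjugate_to_times[OF assms that] by metis
  show "cyclic_group (Zp_star p)"
    by (rule cyclic_Zp_star[OF assms])
  fix m0 assume m0: "m0 \<in> carrier (Zp_star p)" "generate (Zp_star p) {m0} = carrier (Zp_star p)"
  show "subgroup (H_sub p m0 d) (Zp_star p)" for d
    by (rule subgroup_H_sub[OF assms m0(1)])
  show "card (H_sub p m0 d) = (p - 1) div d" if "d dvd p - 1" for d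
    by (rule card_H_sub[OF assms m0 that])
  show "subgroup (rep_subgroup p m0 i) (AutZp2 p)" if "valid_rep p i" for i
    by (rule subgroup_rep[OF assms m0 that])
  show "normalizer (AutZp2 p) (rep_subgroup p m0 i) = rep_normalizer p m0 i" if "valid_rep p i" for i
    by (rule normalizer_rep[OF assms m0 that])
  show "\<exists>!i. valid_rep p i \<and> conjugate_in (AutZp2 p) K (rep_subgroup p m0 i)"
    if "subgroup K (AutZp2 p)" for K
    by (rule ex1_rep[OF assms m0 that])
qed

end
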